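(* Let $\mathsf G$ be a complex semisimple Lie group, $X$ a closed Riemann surface of genus at least two, and let $(\mathcal G,\Phi_0)$ be the Fuchsian $\mathsf G$-Higgs bundle with its harmonic metric $\rho$. Then the first variation at the Fuchsian point of the harmonic metric vanishes for the Dolbeault deformations $(\phi(q),\beta(b))$, $(q,b)\in Q(X,\mathfrak g)\oplus\overline{Q(X,\mathfrak g)}$. That is, if $(\nabla^{0,1}_\varepsilon,\Phi_\varepsilon)$ is a smooth family of $\mathsf G$-Higgs bundle structures equal to the Fuchsian one at $\varepsilon=0$ with $\frac{d}{d\varepsilon}|_{0}\nabla^{0,1}_\varepsilon=\beta(b)$ and $\frac{d}{d\varepsilon}|_{0}\Phi_\varepsilon=\phi(q)$, and $\rho_\varepsilon$ is the corresponding smooth family of harmonic metrics with $\rho_0=\rho$, then $\frac{d}{d\varepsilon}|_{0}\rho_\varepsilon=0$.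
   Context: Lie theory. $\mathfrak g=\mathrm{Lie}(\mathsf G)$ has rank $l$; $(\cdot,\cdot)_{\mathfrak g}$ is the Killing form normalized so that a longest root has squared length $2$. $\mathfrak{sl}(2)$ has generators $a,x,y$ with $[a,x]=x$, $[a,y]=-y$, $[x,y]=-a$; a principal embedding $\mathfrak{sl}(2)\hookrightarrow\mathfrak g$ is fixed, with $a,x,y$ mapping to $a,X_0,Y_0$. Under it $\mathfrak g=\bigoplus_{i=1}^l\mathfrak v_i$ with $\mathfrak v_i$ irreducible of dimension $2m_i+1$, $m_i<m_{i+1}$ (exponents). $\mathfrak g_m$ is the $m$-eigenspace of $\mathrm{ad}(a)$. $\rho$ is a Cartan involution preserving the principal subalgebra with $Y_0=\rho(X_0)$. $e_i\in\mathfrak v_i$ are normalized highest weight vectors: $-(e_i,\rho(e_i))_{\mathfrak g}=d(\mathfrak g)$, the Dynkin index $d(\mathfrak g)=(a,a)_{\mathfrak g}/\frac12$. Higgs bundles. A $\mathsf G$-Higgs bundle is a holomorphic principal $\mathsf G$-bundle $P$ with $\Phi\in H^0(X,(P\times_{\mathsf G}\mathfrak g)\otimes K)$. A harmonic metric is a smooth family $\rho$ of Cartan involutions on the fibres of the adjoint bundle such that, with $\nabla$ its Chern connection (so $\nabla(\rho)=0$), $F_\nabla-[\Phi,\rho(\Phi)]=0$; stable Higgs bundles admit one. Fuchsian Higgs bundle. $\mathcal G=\bigoplus_m\mathfrak g_m\otimes K^m$ with $\Phi_0=Y_0\otimes1\in\mathfrak g_{-1}\otimes K^{-1}\otimes K$;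 its harmonic metric $\rho$ is the family of Cartan involutions induced by $\rho$ on $\mathfrak g$ and the hermitian metric on $K$ coming from the hyperbolic metric of curvature $-1$ ($\langle dz,dz\rangle=h^{-1}$ where the area form is $ih\,dz\wedge d\bar z$). Deformations. $Q(X,\mathfrak g)=\bigoplus_{i=1}^lH^0(X,K^{m_i+1})$; $\phi(q)=\sum_iq_i\otimes e_i\in\Omega^{1,0}(X,\mathcal G)$ for $q=(q_1,\dots,q_l)$, and $\beta(b)=\rho(\phi(\bar b))\in\Omega^{0,1}(X,\mathcal G)$ for $b\in\overline{Q(X,\mathfrak g)}$. *)

theory Defs
  imports "HOL-Analysis.Analysis" "HOL-Algebra.Group" "HOL-Homology.Homology"
begin
text \<open>Regularity on open sets; all derivatives are two-sided, so these are only used for open \<open>S\<close>.\<close>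

primrec Ck_on :: "nat \<Rightarrow> 'a::real_normed_vector set \<Rightarrow> ('a \<Rightarrow> 'b::real_normed_vector) \<Rightarrow> bool" where
  "Ck_on 0 S f \<longleftrightarrow> continuous_on S f"
| "Ck_on (Suc k) S f \<longleftrightarrow>
     (\<forall>x\<in>S. f differentiable (at x)) \<and> (\<forall>v. Ck_on k S (\<lambda>x. frechet_derivative f (at x) v))"

definition smooth_on :: "'a::real_normed_vector set \<Rightarrow> ('a \<Rightarrow> 'b::real_normed_vector) \<Rightarrow> bool" where
  "smooth_on S f \<longleftrightarrow> (\<forall>k. Ck_on k S f)"

text \<open>Complex differentiability of maps between complex vector spaces; \<open>J\<close> and \<open>J'\<close> are
  multiplication by \<open>\<i>\<close> on source and target.\<close>

definition holo_map ::
  "('a::real_normed_vector \<Rightarrow> 'a) \<Rightarrow> ('b::real_normed_vector \<Rightarrow> 'b) \<Rightarrow> 'a set \<Rightarrow> ('a \<Rightarrow> 'b) \<Rightarrow> bool" where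
  "holo_map J J' S f \<longleftrightarrow>
     (\<forall>x\<in>S. \<exists>f'. (f has_derivative f') (at x) \<and> (\<forall>v. f' (J v) = J' (f' v)))"

definition wirt_z :: "(complex \<Rightarrow> complex^'n) \<Rightarrow> complex \<Rightarrow> complex^'n" where
  "wirt_z f w = (1/2) *s (frechet_derivative f (at w) 1 - \<i> *s frechet_derivative f (at w) \<i>)"

definition wirt_zbar :: "(complex \<Rightarrow> complex^'n) \<Rightarrow> complex \<Rightarrow> complex^'n" where
  "wirt_zbar f w = (1/2) *s (frechet_derivative f (at w) 1 + \<i> *s frechet_derivative f (at w) \<i>)"

text \<open>A finite-dimensional complex Lie algebra is a bracket \<open>br\<close> on \<open>complex^'n\<close>.\<close>

definition lie_algebra :: "(complex^'n \<Rightarrow> complex^'n \<Rightarrow> complex^'n) \<Rightarrow> bool" where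
  "lie_algebra br \<longleftrightarrow>
     (\<forall>x. Vector_Spaces.linear (*s) (*s) (br x)) \<and>
     (\<forall>y. Vector_Spaces.linear (*s) (*s) (\<lambda>x. br x y)) \<and>
     (\<forall>x. br x x = 0) \<and>
     (\<forall>x y z. br x (br y z) + br y (br z x) + br z (br x y) = 0)"

definition lie_ideal :: "(complex^'n \<Rightarrow> complex^'n \<Rightarrow> complex^'n) \<Rightarrow> (complex^'n) set \<Rightarrow> bool" where
  "lie_ideal br I \<longleftrightarrow> vec.subspace I \<and> (\<forall>x. \<forall>y\<in>I. br x y \<in> I)"

definition bracket_span ::
  "(complex^'n \<Rightarrow> complex^'n \<Rightarrow> complex^'n) \<Rightarrow> (complex^'n) set \<Rightarrow> (complex^'n) set \<Rightarrow> (complex^'n) set" where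
  "bracket_span br S T = vec.span {br x y | x y. x \<in> S \<and> y \<in> T}"

primrec derived_series ::
  "(complex^'n \<Rightarrow> complex^'n \<Rightarrow> complex^'n) \<Rightarrow> (complex^'n) set \<Rightarrow> nat \<Rightarrow> (complex^'n) set" where
  "derived_series br S 0 = S"
| "derived_series br S (Suc k) = bracket_span br (derived_series br S k) (derived_series br S k)"

primrec lower_central_series ::
  "(complex^'n \<Rightarrow> complex^'n \<Rightarrow> complex^'n) \<Rightarrow> (complex^'n) set \<Rightarrow> nat \<Rightarrow> (complex^'n) set" where
  "lower_central_series br S 0 = S"
| "lower_central_series br S (Suc k) = bracket_span br S (lower_central_series br S k)"

definition semisimple_lie_algebra :: "(complex^'n \<Rightarrow> complex^'n \<Rightarrow> complex^'n) \<Rightarrow> bool" where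
  "semisimple_lie_algebra br \<longleftrightarrow>
     lie_algebra br \<and> (\<forall>I. lie_ideal br I \<and> (\<exists>k. derived_series br I k = {0}) \<longrightarrow> I = {0})"

definition killing_form :: "(complex^'n \<Rightarrow> complex^'n \<Rightarrow> complex^'n) \<Rightarrow> complex^'n \<Rightarrow> complex^'n \<Rightarrow> complex" where
  "killing_form br x y = trace (matrix (\<lambda>v. br x (br y v)))"

definition cartan_subalgebra :: "(complex^'n \<Rightarrow> complex^'n \<Rightarrow> complex^'n) \<Rightarrow> (complex^'n) set \<Rightarrow> bool" where
  "cartan_subalgebra br H \<longleftrightarrow>
     vec.subspace H \<and> (\<forall>x\<in>H. \<forall>y\<in>H. br x y \<in> H) \<and>
     (\<exists>k. lower_central_series br H k = {0}) \<and>
     {x. \<forall>y\<in>H. br x y \<in> H} = H"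

definition is_root ::
  "(complex^'n \<Rightarrow> complex^'n \<Rightarrow> complex^'n) \<Rightarrow> (complex^'n) set \<Rightarrow> (complex^'n \<Rightarrow> complex) \<Rightarrow> bool" where
  "is_root br H \<alpha> \<longleftrightarrow>
     (\<exists>y\<in>H. \<alpha> y \<noteq> 0) \<and> (\<exists>x. x \<noteq> 0 \<and> (\<forall>y\<in>H. br y x = \<alpha> y *s x))"

definition root_dual ::
  "(complex^'n \<Rightarrow> complex^'n \<Rightarrow> complex) \<Rightarrow> (complex^'n) set \<Rightarrow> (complex^'n \<Rightarrow> complex) \<Rightarrow> complex^'n \<Rightarrow> bool" where
  "root_dual B H \<alpha> t \<longleftrightarrow> t \<in> H \<and> (\<forall>y\<in>H. B t y = \<alpha> y)"

text \<open>The positive multiple of the Killing form for which the largest squared length of a root is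
  \<open>2\<close>. The squared length of \<open>\<alpha>\<close> is \<open>B t t\<close> with \<open>t\<close> the \<open>B\<close>-dual of \<open>\<alpha>\<close>; it is a positive real
  number.\<close>

definition normalized_killing_form ::
  "(complex^'n \<Rightarrow> complex^'n \<Rightarrow> complex^'n) \<Rightarrow> (complex^'n \<Rightarrow> complex^'n \<Rightarrow> complex) \<Rightarrow> bool" where
  "normalized_killing_form br B \<longleftrightarrow>
     (\<exists>c::real. c > 0 \<and> (\<forall>x y. B x y = of_real c * killing_form br x y)) \<and>
     (\<exists>H. cartan_subalgebra br H \<and>
        (\<exists>\<alpha> t. is_root br H \<alpha> \<and> root_dual B H \<alpha> t \<and> B t t = 2) \<and>
        (\<forall>\<alpha> t. is_root br H \<alpha> \<and> root_dual B H \<alpha> t \<longrightarrow> Re (B t t) \<le> 2))"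

text \<open>The rank: the least multiplicity of \<open>0\<close> as a root of the characteristic polynomial of
  \<open>ad x\<close>, i.e. the least dimension of a generalized null space. It is the common dimension of
  the Cartan subalgebras.\<close>

definition lie_rank :: "(complex^'n \<Rightarrow> complex^'n \<Rightarrow> complex^'n) \<Rightarrow> nat" where
  "lie_rank br = (LEAST r. \<exists>x. r = vec.dim {v. \<exists>k. (br x ^^ k) v = 0})"

text \<open>Images \<open>a\<close>, \<open>X\<^sub>0\<close>, \<open>Y\<^sub>0\<close> of the generators of \<open>\<ss>\<ll>(2)\<close> under a principal embedding. The
  embedding is principal when the nilpotent element \<open>X\<^sub>0\<close> is regular: its centralizer
  has dimension equal to the rank.\<close>

definition principal_sl2 ::
  "(complex^'n \<Rightarrow> complex^'n \<Rightarrow> complex^'n) \<Rightarrow> complex^'n \<Rightarrow> complex^'n \<Rightarrow> complex^'n \<Rightarrow> bool" where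
  "principal_sl2 br a X0 Y0 \<longleftrightarrow>
     vec.independent {a, X0, Y0} \<and> card {a, X0, Y0} = 3 \<and>
     br a X0 = X0 \<and> br a Y0 = - Y0 \<and> br X0 Y0 = - a \<and>
     vec.dim {v. br X0 v = 0} = lie_rank br"

definition irreducible_submodule ::
  "(complex^'n \<Rightarrow> complex^'n \<Rightarrow> complex^'n) \<Rightarrow> (complex^'n) set \<Rightarrow> (complex^'n) set \<Rightarrow> bool" where
  "irreducible_submodule br S V \<longleftrightarrow>
     vec.subspace V \<and> V \<noteq> {0} \<and> (\<forall>s\<in>S. br s ` V \<subseteq> V) \<and>
     (\<forall>U. vec.subspace U \<and> U \<subseteq> V \<and> (\<forall>s\<in>S. br s ` U \<subseteq> U) \<longrightarrow> U = {0} \<or> U = V)"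

text \<open>Exponents may repeat (they do for \<open>D\<^bsub>2k\<^esub>\<close> and for non-simple algebras), so \<open>m\<close> is only
  required to be weakly increasing; then \<open>V\<close> is any such decomposition.\<close>

definition exponent_decomposition ::
  "(complex^'n \<Rightarrow> complex^'n \<Rightarrow> complex^'n) \<Rightarrow> complex^'n \<Rightarrow> complex^'n \<Rightarrow> complex^'n
    \<Rightarrow> (nat \<Rightarrow> (complex^'n) set) \<Rightarrow> (nat \<Rightarrow> nat) \<Rightarrow> bool" where
  "exponent_decomposition br a X0 Y0 V m \<longleftrightarrow>
     (\<forall>i\<in>{1..lie_rank br}. irreducible_submodule br {a, X0, Y0} (V i) \<and> vec.dim (V i) = 2 * m i + 1) \<and>
     (\<forall>i\<in>{1..<lie_rank br}. m i \<le> m (Suc i)) \<and>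
     (\<forall>v. \<exists>u. (\<forall>i\<in>{1..lie_rank br}. u i \<in> V i) \<and> v = (\<Sum>i=1..lie_rank br. u i)) \<and>
     (\<forall>u. (\<forall>i\<in>{1..lie_rank br}. u i \<in> V i) \<and> (\<Sum>i=1..lie_rank br. u i) = 0
        \<longrightarrow> (\<forall>i\<in>{1..lie_rank br}. u i = 0))"

definition grading ::
  "(complex^'n \<Rightarrow> complex^'n \<Rightarrow> complex^'n) \<Rightarrow> complex^'n \<Rightarrow> int \<Rightarrow> (complex^'n) set" where
  "grading br a m = {v. br a v = of_int m *s v}"

text \<open>\<open>T\<close> is the additive map equal to \<open>f m\<close> on the summand \<open>\<gg>\<^sub>m\<close> of \<open>\<gg> = \<Oplus>\<^sub>m \<gg>\<^sub>m\<close>.\<close>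

definition graded_map ::
  "(complex^'n \<Rightarrow> complex^'n \<Rightarrow> complex^'n) \<Rightarrow> complex^'n \<Rightarrow> (int \<Rightarrow> complex^'n \<Rightarrow> complex^'n)
    \<Rightarrow> (complex^'n \<Rightarrow> complex^'n) \<Rightarrow> bool" where
  "graded_map br a f T \<longleftrightarrow>
     (\<forall>S v. finite S \<and> (\<forall>m\<in>S. v m \<in> grading br a m) \<longrightarrow> T (\<Sum>m\<in>S. v m) = (\<Sum>m\<in>S. f m (v m)))"

text \<open>The form \<open>-\<kappa>(x, \<rho> y)\<close> is automatically hermitian, so \<open>\<kappa>(x, \<rho> x)\<close> is real.\<close>

definition cartan_involution ::
  "(complex^'n \<Rightarrow> complex^'n \<Rightarrow> complex^'n) \<Rightarrow> (complex^'n \<Rightarrow> complex^'n) \<Rightarrow> bool" where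
  "cartan_involution br \<rho> \<longleftrightarrow>
     (\<forall>x y. \<rho> (x + y) = \<rho> x + \<rho> y) \<and> (\<forall>c x. \<rho> (c *s x) = cnj c *s \<rho> x) \<and>
     (\<forall>x. \<rho> (\<rho> x) = x) \<and> (\<forall>x y. \<rho> (br x y) = br (\<rho> x) (\<rho> y)) \<and>
     (\<forall>x. x \<noteq> 0 \<longrightarrow> Re (- killing_form br x (\<rho> x)) > 0)"

definition dynkin_index :: "(complex^'n \<Rightarrow> complex^'n \<Rightarrow> complex) \<Rightarrow> complex^'n \<Rightarrow> complex" where
  "dynkin_index B a = B a a / (1/2)"

text \<open>A Hausdorff topological group with an atlas \<open>C\<close> of charts (domain, map) into \<open>complex^'n\<close>
  in which multiplication and inversion are holomorphic.\<close>

definition complex_lie_group ::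
  "'g::t2_space monoid \<Rightarrow> ('g set \<times> ('g \<Rightarrow> complex^'n)) set \<Rightarrow> bool" where
  "complex_lie_group G C \<longleftrightarrow>
     group G \<and> carrier G = UNIV \<and>
     continuous_on UNIV (\<lambda>(x, y). x \<otimes>\<^bsub>G\<^esub> y) \<and> continuous_on UNIV (\<lambda>x. inv\<^bsub>G\<^esub> x) \<and>
     (\<Union>(W, \<psi>)\<in>C. W) = UNIV \<and>
     (\<forall>(W, \<psi>)\<in>C. open W \<and> open (\<psi> ` W) \<and> homeomorphism W (\<psi> ` W) \<psi> (inv_into W \<psi>)) \<and>
     (\<forall>(W, \<psi>)\<in>C. \<forall>(W', \<psi>')\<in>C.
        holo_map ((*s) \<i>) ((*s) \<i>) (\<psi> ` (W \<inter> W')) (\<psi>' \<circ> inv_into W \<psi>) \<and>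
        holo_map ((*s) \<i>) ((*s) \<i>) (\<psi> ` {x\<in>W. inv\<^bsub>G\<^esub> x \<in> W'})
          (\<lambda>u. \<psi>' (inv\<^bsub>G\<^esub> (inv_into W \<psi> u)))) \<and>
     (\<forall>(W, \<psi>)\<in>C. \<forall>(W', \<psi>')\<in>C. \<forall>(W'', \<psi>'')\<in>C.
        holo_map (\<lambda>(u, v). (\<i> *s u, \<i> *s v)) ((*s) \<i>)
          {(\<psi> x, \<psi>' y) | x y. x \<in> W \<and> y \<in> W' \<and> x \<otimes>\<^bsub>G\<^esub> y \<in> W''}
          (\<lambda>(u, v). \<psi>'' (inv_into W \<psi> u \<otimes>\<^bsub>G\<^esub> inv_into W' \<psi>' v)))"

text \<open>A chart \<open>(W, \<psi>)\<close> with \<open>\<one> \<in> W\<close>, \<open>\<psi> \<one> = 0\<close> identifies the tangent space at \<open>\<one>\<close> with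
  \<open>complex^'n\<close>. \<open>Ad x\<close> is the differential at \<open>\<one>\<close> of conjugation by \<open>x\<close>, and the bracket of
  \<open>Lie(G)\<close> is the differential at \<open>\<one>\<close> of \<open>Ad\<close>.\<close>

definition Ad ::
  "'g monoid \<Rightarrow> 'g set \<Rightarrow> ('g \<Rightarrow> complex^'n) \<Rightarrow> 'g \<Rightarrow> complex^'n \<Rightarrow> complex^'n" where
  "Ad G W \<psi> x = frechet_derivative (\<lambda>u. \<psi> (x \<otimes>\<^bsub>G\<^esub> inv_into W \<psi> u \<otimes>\<^bsub>G\<^esub> inv\<^bsub>G\<^esub> x)) (at 0)"

definition lie_bracket ::
  "'g monoid \<Rightarrow> 'g set \<Rightarrow> ('g \<Rightarrow> complex^'n) \<Rightarrow> complex^'n \<Rightarrow> complex^'n \<Rightarrow> complex^'n" where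
  "lie_bracket G W \<psi> u v = frechet_derivative (\<lambda>u'. Ad G W \<psi> (inv_into W \<psi> u') v) (at 0) u"

text \<open>An atlas on the space \<open>'x\<close>, indexed by the type \<open>'i\<close>.\<close>

record ('i, 'x) surface =
  chart_dom :: "'i \<Rightarrow> 'x set"
  chart_map :: "'i \<Rightarrow> 'x \<Rightarrow> complex"

definition chart_inv :: "('i, 'x) surface \<Rightarrow> 'i \<Rightarrow> complex \<Rightarrow> 'x" where
  "chart_inv X i = inv_into (chart_dom X i) (chart_map X i)"

definition chart_img :: "('i, 'x) surface \<Rightarrow> 'i \<Rightarrow> complex set" where
  "chart_img X i = chart_map X i ` chart_dom X i"

definition closed_riemann_surface :: "('i, 'x::t2_space) surface \<Rightarrow> bool" where
  "closed_riemann_surface X \<longleftrightarrow>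
     compact (UNIV :: 'x set) \<and> connected (UNIV :: 'x set) \<and>
     (\<Union>i. chart_dom X i) = UNIV \<and>
     (\<forall>i. open (chart_dom X i) \<and> open (chart_img X i) \<and>
        homeomorphism (chart_dom X i) (chart_img X i) (chart_map X i) (chart_inv X i)) \<and>
     (\<forall>i j. (chart_map X j \<circ> chart_inv X i) holomorphic_on
        chart_map X i ` (chart_dom X i \<inter> chart_dom X j))"

text \<open>Genus \<open>g\<close>: the first integral homology group is free of rank \<open>2g\<close>.\<close>

definition has_genus :: "('i, 'x::t2_space) surface \<Rightarrow> nat \<Rightarrow> bool" where
  "has_genus X g \<longleftrightarrow> homology_group 1 (euclidean :: 'x topology) \<cong> free_Abelian_group {..<2 * g}"

text \<open>\<open>dz\<^sub>j / dz\<^sub>i\<close> at the point \<open>p\<close> of the overlap.\<close>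

definition jac :: "('i, 'x) surface \<Rightarrow> 'i \<Rightarrow> 'i \<Rightarrow> 'x \<Rightarrow> complex" where
  "jac X i j p = deriv (chart_map X j \<circ> chart_inv X i) (chart_map X i p)"

text \<open>Sections of \<open>K\<^sup>n\<close>: families \<open>f\<^sub>i\<close> of functions of the coordinate \<open>z\<^sub>i\<close> with
  \<open>f\<^sub>i dz\<^sub>i\<^sup>n = f\<^sub>j dz\<^sub>j\<^sup>n\<close>.\<close>

definition holomorphic_differential ::
  "('i, 'x) surface \<Rightarrow> nat \<Rightarrow> ('i \<Rightarrow> complex \<Rightarrow> complex) \<Rightarrow> bool" where
  "holomorphic_differential X n f \<longleftrightarrow>
     (\<forall>i. f i holomorphic_on chart_img X i) \<and>
     (\<forall>i j. \<forall>p\<in>chart_dom X i \<inter> chart_dom X j.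
        f i (chart_map X i p) = jac X i j p ^ n * f j (chart_map X j p))"

definition Q_space ::
  "('i, 'x) surface \<Rightarrow> nat \<Rightarrow> (nat \<Rightarrow> nat) \<Rightarrow> (nat \<Rightarrow> 'i \<Rightarrow> complex \<Rightarrow> complex) set" where
  "Q_space X l m = {q. \<forall>k\<in>{1..l}. holomorphic_differential X (m k + 1) (q k)}"

definition Q_space_conj ::
  "('i, 'x) surface \<Rightarrow> nat \<Rightarrow> (nat \<Rightarrow> nat) \<Rightarrow> (nat \<Rightarrow> 'i \<Rightarrow> complex \<Rightarrow> complex) set" where
  "Q_space_conj X l m = {b. (\<lambda>k i w. cnj (b k i w)) \<in> Q_space X l m}"

definition laplacian :: "(complex \<Rightarrow> real) \<Rightarrow> complex \<Rightarrow> real" where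
  "laplacian u w =
     (\<Sum>e\<in>Basis. frechet_derivative (\<lambda>w'. frechet_derivative u (at w') e) (at w) e)"

text \<open>Gauss curvature of the conformal metric \<open>E (dx\<^sup>2 + dy\<^sup>2)\<close>.\<close>

definition gauss_curvature :: "(complex \<Rightarrow> real) \<Rightarrow> complex \<Rightarrow> real" where
  "gauss_curvature E w = - laplacian (\<lambda>w'. ln (E w')) w / (2 * E w)"

text \<open>The area form \<open>i h dz \<and> dzbar\<close> equals \<open>2 h dx \<and> dy\<close>, so the metric is
  \<open>2 h (dx\<^sup>2 + dy\<^sup>2)\<close>.\<close>

definition hyperbolic_metric :: "('i, 'x) surface \<Rightarrow> ('i \<Rightarrow> complex \<Rightarrow> real) \<Rightarrow> bool" where
  "hyperbolic_metric X h \<longleftrightarrow>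
     (\<forall>i. smooth_on (chart_img X i) (h i)) \<and>
     (\<forall>i. \<forall>w\<in>chart_img X i. h i w > 0 \<and> gauss_curvature (\<lambda>w'. 2 * h i w') w = -1) \<and>
     (\<forall>i j. \<forall>p\<in>chart_dom X i \<inter> chart_dom X j.
        h i (chart_map X i p) = (cmod (jac X i j p))\<^sup>2 * h j (chart_map X j p))"

text \<open>A holomorphic principal \<open>G\<close>-bundle, given by its holomorphic cocycle
  with respect to trivializations over the charts of \<open>X\<close>.\<close>

definition holomorphic_principal_bundle ::
  "'g::t2_space monoid \<Rightarrow> ('g set \<times> ('g \<Rightarrow> complex^'n)) set \<Rightarrow> ('i, 'x::t2_space) surface
    \<Rightarrow> ('i \<Rightarrow> 'i \<Rightarrow> 'x \<Rightarrow> 'g) \<Rightarrow> bool" where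
  "holomorphic_principal_bundle G C X \<tau> \<longleftrightarrow>
     (\<forall>i j. continuous_on (chart_dom X i \<inter> chart_dom X j) (\<tau> i j)) \<and>
     (\<forall>i j. \<forall>(W, \<psi>)\<in>C. holo_map ((*) \<i>) ((*s) \<i>)
        (chart_map X i ` {p \<in> chart_dom X i \<inter> chart_dom X j. \<tau> i j p \<in> W})
        (\<lambda>w. \<psi> (\<tau> i j (chart_inv X i w)))) \<and>
     (\<forall>i j k. \<forall>p\<in>chart_dom X i \<inter> chart_dom X j \<inter> chart_dom X k.
        \<tau> i j p \<otimes>\<^bsub>G\<^esub> \<tau> j k p = \<tau> i k p)"

definition ad_bundle ::
  "'g monoid \<Rightarrow> 'g set \<Rightarrow> ('g \<Rightarrow> complex^'n) \<Rightarrow> ('i \<Rightarrow> 'i \<Rightarrow> 'x \<Rightarrow> 'g)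
    \<Rightarrow> 'i \<Rightarrow> 'i \<Rightarrow> 'x \<Rightarrow> complex^'n \<Rightarrow> complex^'n" where
  "ad_bundle G W \<psi> \<tau> i j p = Ad G W \<psi> (\<tau> i j p)"

text \<open>Smooth \<open>(r,s)\<close>-forms, \<open>r, s \<le> 1\<close>, with values in the bundle with transition maps \<open>T\<close>. Over
  the chart \<open>i\<close> a form is given by its coefficient, a function of the coordinate \<open>z\<^sub>i\<close>.\<close>

definition bundle_form ::
  "('i, 'x) surface \<Rightarrow> ('i \<Rightarrow> 'i \<Rightarrow> 'x \<Rightarrow> complex^'n \<Rightarrow> complex^'n) \<Rightarrow> nat \<Rightarrow> nat
    \<Rightarrow> ('i \<Rightarrow> complex \<Rightarrow> complex^'n) \<Rightarrow> bool" where
  "bundle_form X T r s f \<longleftrightarrow>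
     (\<forall>i. smooth_on (chart_img X i) (f i)) \<and>
     (\<forall>i j. \<forall>p\<in>chart_dom X i \<inter> chart_dom X j.
        f i (chart_map X i p) =
          (jac X i j p ^ r * cnj (jac X i j p) ^ s) *s T i j p (f j (chart_map X j p)))"

text \<open>A \<open>G\<close>-Higgs bundle structure on the smooth bundle underlying a holomorphic bundle:
  every holomorphic structure on it is given by \<open>\<nabla>\<^sup>0\<^sup>,\<^sup>1\<close>, which in the given
  holomorphic trivializations is the standard Cauchy-Riemann operator plus the \<open>(0,1)\<close>-form \<open>A\<close>; the Higgs field \<open>\<Phi>\<close> is a
  holomorphic \<open>(1,0)\<close>-form, \<open>\<nabla>\<^sup>0\<^sup>,\<^sup>1 \<Phi> = 0\<close>.\<close>

definition higgs_structure ::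
  "(complex^'n \<Rightarrow> complex^'n \<Rightarrow> complex^'n) \<Rightarrow> ('i, 'x) surface
    \<Rightarrow> ('i \<Rightarrow> 'i \<Rightarrow> 'x \<Rightarrow> complex^'n \<Rightarrow> complex^'n)
    \<Rightarrow> ('i \<Rightarrow> complex \<Rightarrow> complex^'n) \<Rightarrow> ('i \<Rightarrow> complex \<Rightarrow> complex^'n) \<Rightarrow> bool" where
  "higgs_structure br X T A \<Phi> \<longleftrightarrow>
     bundle_form X T 0 1 A \<and> bundle_form X T 1 0 \<Phi> \<and>
     (\<forall>i. \<forall>w\<in>chart_img X i. wirt_zbar (\<Phi> i) w + br (A i w) (\<Phi> i w) = 0)"

text \<open>The connection \<open>\<nabla> = d + A' dz + A dzbar\<close> satisfies \<open>\<nabla>(\<rho>) = 0\<close>, i.e.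
  \<open>\<nabla>(\<rho> s) = \<rho>(\<nabla> s)\<close>; by the Leibniz rule it is enough to take locally constant \<open>s = v\<close>. The two
  equations are the components along \<open>dz\<close> and \<open>dzbar\<close>, which \<open>\<rho>\<close> interchanges. They
  determine \<open>A'\<close>.\<close>

definition chern_connection ::
  "(complex^'n \<Rightarrow> complex^'n \<Rightarrow> complex^'n) \<Rightarrow> ('i, 'x) surface
    \<Rightarrow> ('i \<Rightarrow> complex \<Rightarrow> complex^'n \<Rightarrow> complex^'n)
    \<Rightarrow> ('i \<Rightarrow> complex \<Rightarrow> complex^'n) \<Rightarrow> ('i \<Rightarrow> complex \<Rightarrow> complex^'n) \<Rightarrow> bool" where
  "chern_connection br X \<rho> A A' \<longleftrightarrow>
     (\<forall>i. smooth_on (chart_img X i) (A' i)) \<and>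
     (\<forall>i. \<forall>w\<in>chart_img X i. \<forall>v.
        wirt_z (\<lambda>w'. \<rho> i w' v) w + br (A' i w) (\<rho> i w v) = \<rho> i w (br (A i w) v) \<and>
        wirt_zbar (\<lambda>w'. \<rho> i w' v) w + br (A i w) (\<rho> i w v) = \<rho> i w (br (A' i w) v))"

text \<open>Coefficient of \<open>dz \<and> dzbar\<close> in the curvature of \<open>d + A' dz + A dzbar\<close>.\<close>

definition curvature ::
  "(complex^'n \<Rightarrow> complex^'n \<Rightarrow> complex^'n) \<Rightarrow> (complex \<Rightarrow> complex^'n) \<Rightarrow> (complex \<Rightarrow> complex^'n)
    \<Rightarrow> complex \<Rightarrow> complex^'n" where
  "curvature br A' A w = wirt_z A w - wirt_zbar A' w + br (A' w) (A w)"

definition cartan_family ::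
  "(complex^'n \<Rightarrow> complex^'n \<Rightarrow> complex^'n) \<Rightarrow> ('i, 'x) surface
    \<Rightarrow> ('i \<Rightarrow> 'i \<Rightarrow> 'x \<Rightarrow> complex^'n \<Rightarrow> complex^'n)
    \<Rightarrow> ('i \<Rightarrow> complex \<Rightarrow> complex^'n \<Rightarrow> complex^'n) \<Rightarrow> bool" where
  "cartan_family br X T \<rho> \<longleftrightarrow>
     (\<forall>i v. smooth_on (chart_img X i) (\<lambda>w. \<rho> i w v)) \<and>
     (\<forall>i. \<forall>w\<in>chart_img X i. cartan_involution br (\<rho> i w)) \<and>
     (\<forall>i j v. \<forall>p\<in>chart_dom X i \<inter> chart_dom X j.
        \<rho> i (chart_map X i p) (T i j p v) = T i j p (\<rho> j (chart_map X j p) v))"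

text \<open>For \<open>\<Phi> = \<phi> dz\<close> one has \<open>\<rho>(\<Phi>) = \<rho>(\<phi>) dzbar\<close> and
  \<open>[\<Phi>, \<rho>(\<Phi>)] = [\<phi>, \<rho>(\<phi>)] dz \<and> dzbar\<close>.\<close>

definition harmonic_metric ::
  "(complex^'n \<Rightarrow> complex^'n \<Rightarrow> complex^'n) \<Rightarrow> ('i, 'x) surface
    \<Rightarrow> ('i \<Rightarrow> 'i \<Rightarrow> 'x \<Rightarrow> complex^'n \<Rightarrow> complex^'n)
    \<Rightarrow> ('i \<Rightarrow> complex \<Rightarrow> complex^'n) \<Rightarrow> ('i \<Rightarrow> complex \<Rightarrow> complex^'n)
    \<Rightarrow> ('i \<Rightarrow> complex \<Rightarrow> complex^'n \<Rightarrow> complex^'n) \<Rightarrow> bool" where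
  "harmonic_metric br X T A \<Phi> \<rho> \<longleftrightarrow>
     cartan_family br X T \<rho> \<and>
     (\<exists>A'. chern_connection br X \<rho> A A' \<and>
        (\<forall>i. \<forall>w\<in>chart_img X i. curvature br (A' i) (A i) w - br (\<Phi> i w) (\<rho> i w (\<Phi> i w)) = 0))"

text \<open>The adjoint bundle is \<open>\<Oplus>\<^sub>m \<gg>\<^sub>m \<otimes> K\<^sup>m\<close>, trivialized on \<open>\<gg>\<^sub>m \<otimes> K\<^sup>m\<close> by the frame \<open>dz\<^sub>i\<^sup>m\<close>. In
  these trivializations the Higgs field \<open>Y\<^sub>0 \<otimes> 1\<close> has the constant coefficient \<open>Y\<^sub>0\<close>.\<close>

definition fuchsian_bundle ::
  "(complex^'n \<Rightarrow> complex^'n \<Rightarrow> complex^'n) \<Rightarrow> complex^'n \<Rightarrow> ('i, 'x) surface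
    \<Rightarrow> ('i \<Rightarrow> 'i \<Rightarrow> 'x \<Rightarrow> complex^'n \<Rightarrow> complex^'n) \<Rightarrow> bool" where
  "fuchsian_bundle br a X T \<longleftrightarrow>
     (\<forall>i j. \<forall>p\<in>chart_dom X i \<inter> chart_dom X j.
        graded_map br a (\<lambda>m v. (jac X i j p powi m) *s v) (T i j p))"

text \<open>Since \<open>\<langle>dz, dz\<rangle> = h\<^sup>-\<^sup>1\<close>, the metric maps \<open>dz\<^sup>m\<close> to \<open>h\<^sup>-\<^sup>m dz\<^sup>-\<^sup>m\<close> under the conjugate-linear
  identification of \<open>K\<^sup>m\<close> with its dual; so \<open>\<rho>(v \<otimes> dz\<^sup>m) = \<rho>\<^sub>0(v) \<otimes> h\<^sup>-\<^sup>m dz\<^sup>-\<^sup>m\<close>.\<close>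

definition fuchsian_metric ::
  "(complex^'n \<Rightarrow> complex^'n \<Rightarrow> complex^'n) \<Rightarrow> complex^'n \<Rightarrow> (complex^'n \<Rightarrow> complex^'n)
    \<Rightarrow> ('i, 'x) surface \<Rightarrow> ('i \<Rightarrow> complex \<Rightarrow> real)
    \<Rightarrow> ('i \<Rightarrow> complex \<Rightarrow> complex^'n \<Rightarrow> complex^'n) \<Rightarrow> bool" where
  "fuchsian_metric br a \<rho>0 X h \<rho> \<longleftrightarrow>
     (\<forall>i. \<forall>w\<in>chart_img X i.
        graded_map br a (\<lambda>m v. (of_real (h i w) powi (- m)) *s \<rho>0 v) (\<rho> i w))"

text \<open>Coefficients of \<open>\<phi>(q) = \<Sum>\<^sub>k q\<^sub>k \<otimes> e\<^sub>k\<close> along \<open>dz\<close> and of \<open>\<beta>(b) = \<rho>(\<phi>(cnj b))\<close> along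
  \<open>dzbar\<close>, in the same trivializations.\<close>

definition phi_form ::
  "nat \<Rightarrow> (nat \<Rightarrow> complex^'n) \<Rightarrow> (nat \<Rightarrow> 'i \<Rightarrow> complex \<Rightarrow> complex) \<Rightarrow> 'i \<Rightarrow> complex \<Rightarrow> complex^'n" where
  "phi_form l e q i w = (\<Sum>k=1..l. q k i w *s e k)"

definition beta_form ::
  "nat \<Rightarrow> (nat \<Rightarrow> complex^'n) \<Rightarrow> ('i \<Rightarrow> complex \<Rightarrow> complex^'n \<Rightarrow> complex^'n)
    \<Rightarrow> (nat \<Rightarrow> 'i \<Rightarrow> complex \<Rightarrow> complex) \<Rightarrow> 'i \<Rightarrow> complex \<Rightarrow> complex^'n" where
  "beta_form l e \<rho> b i w = \<rho> i w (phi_form l e (\<lambda>k i w. cnj (b k i w)) i w)"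

end

theory Submission
  imports Defs
begin

text \<open>
  The derivative of the metrics at time \<open>0\<close> is \<open>ad(s) \<circ> \<rho>\<close> for a section \<open>s\<close> of the adjoint
  bundle with \<open>\<rho>(s) = -s\<close>, because an infinitesimal automorphism of a semisimple Lie algebra is an inner
  derivation. Differentiating \<open>\<nabla>(\<rho>) = 0\<close> gives \<open>dA'/d\<epsilon> = \<rho>(\<beta>) - \<nabla>\<^sup>1\<^sup>,\<^sup>0 s\<close>, and
  differentiating Hitchin's equation gives \<open>\<nabla>\<^sup>0\<^sup>,\<^sup>1 \<nabla>\<^sup>1\<^sup>,\<^sup>0 s = [\<Phi>\<^sub>0, [s, \<rho>(\<Phi>\<^sub>0)]]\<close>: the terms in
  \<open>\<beta>(b)\<close> vanish because \<open>b\<close> is antiholomorphic, those in \<open>\<phi>(q)\<close> because the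
  \<open>e\<^sub>k\<close> are highest weight vectors and \<open>\<rho>(\<Phi>\<^sub>0)\<close> is a multiple of \<open>X\<^sub>0\<close>. Hence the Laplacian
  of \<open>|s|\<^sup>2\<close> is \<open>8 (|[s, \<Phi>\<^sub>0]|\<^sup>2 + |\<nabla>\<^sup>1\<^sup>,\<^sup>0 s|\<^sup>2)\<close>. At a maximum of \<open>|s|\<^sup>2\<close> on the compact
  surface it is nonpositive, so there \<open>s\<close> commutes with \<open>Y\<^sub>0\<close>, and since \<open>\<rho>(s) = -s\<close>
  with the whole principal subalgebra. The centralizer of that subalgebra contains no nonzero
  such element, so the maximum of \<open>|s|\<^sup>2\<close> is \<open>0\<close>.
\<close>

section \<open>Calculus of smooth maps\<close>

text \<open>Openness makes \<open>f\<close> and \<open>g\<close> agree near each point of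
  \<open>S\<close>, so their two-sided derivatives agree on \<open>S\<close> and the induction
  passes to them.\<close>

lemma Ck_on_cong:
  assumes "open S" and "\<And>x. x \<in> S \<Longrightarrow> f x = g x" and "Ck_on k S f"
  shows "Ck_on k S g"
  using assms
proof (induction k arbitrary: f g)
  case 0
  then show ?case by (simp cong: continuous_on_cong)
next
  case (Suc k)
  have d: "f differentiable (at x)" if "x \<in> S" for x using Suc.prems(3) that by simp
  have g: "(g has_derivative frechet_derivative f (at x)) (at x)" if "x \<in> S" for x
    by (rule has_derivative_transform_within_open[OF _ Suc.prems(1) that, of f])
       (use d[OF that] Suc.prems(2) in \<open>simp_all add: frechet_derivative_works\<close>)
  have eq: "frechet_derivative f (at x) = frechet_derivative g (at x)" if "x \<in> S" for x
    using frechet_derivative_at[OF g[OF that]] .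
  have "Ck_on k S (\<lambda>x. frechet_derivative g (at x) v)" for v
    by (rule Suc.IH[OF Suc.prems(1), of "\<lambda>x. frechet_derivative f (at x) v"]) (use Suc.prems(3) eq in auto)
  then show ?case using g by (auto simp: differentiable_def)
qed

lemma Ck_on_mono: "Ck_on (Suc k) S f \<Longrightarrow> Ck_on k S f"
proof (induction k arbitrary: f)
  case 0
  then show ?case
    by (auto intro!: continuous_at_imp_continuous_on differentiable_imp_continuous_within)
next
  case (Suc k)
  then show ?case by (metis Ck_on.simps(2))
qed

lemma smooth_on_differentiable: "smooth_on S f \<Longrightarrow> x \<in> S \<Longrightarrow> f differentiable (at x)"
  unfolding smooth_on_def by (metis Ck_on.simps(2))

lemma smooth_on_has_derivative:
  "smooth_on S f \<Longrightarrow> x \<in> S \<Longrightarrow> (f has_derivative frechet_derivative f (at x)) (at x)"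
  using smooth_on_differentiable frechet_derivative_works by blast

lemma smooth_on_dd: "smooth_on S f \<Longrightarrow> smooth_on S (\<lambda>x. frechet_derivative f (at x) v)"
  unfolding smooth_on_def by (metis Ck_on.simps(2))

lemma smooth_on_continuous: "smooth_on S f \<Longrightarrow> continuous_on S f"
  unfolding smooth_on_def by (metis Ck_on.simps(1))

lemma smooth_on_cong:
  "open S \<Longrightarrow> (\<And>x. x \<in> S \<Longrightarrow> f x = g x) \<Longrightarrow> smooth_on S f \<Longrightarrow> smooth_on S g"
  unfolding smooth_on_def using Ck_on_cong by blast

lemma frechet_derivative_eqI:
  "(f has_derivative f') (at x) \<Longrightarrow> frechet_derivative f (at x) v = f' v"
  by (simp add: frechet_derivative_at[symmetric])

lemma Ck_on_const: "Ck_on k S (\<lambda>x. c)"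
  by (induction k arbitrary: c) auto

lemma smooth_on_const: "smooth_on S (\<lambda>x. c)"
  by (simp add: smooth_on_def Ck_on_const)

lemma Ck_on_bounded_linear:
  assumes L: "bounded_linear L" and S: "open S"
  shows "Ck_on k S f \<Longrightarrow> Ck_on k S (\<lambda>x. L (f x))"
proof (induction k arbitrary: f)
  case 0
  then show ?case by (auto intro: bounded_linear.continuous_on[OF L])
next
  case (Suc k)
  have d: "((\<lambda>x. L (f x)) has_derivative (\<lambda>v. L (frechet_derivative f (at x) v))) (at x)" if "x \<in> S" for x
    using Suc.prems that by (auto simp: frechet_derivative_works intro!: bounded_linear.has_derivative[OF L])
  have "Ck_on k S (\<lambda>x. frechet_derivative (\<lambda>x. L (f x)) (at x) v)" for v
    by (rule Ck_on_cong[OF S, of "\<lambda>x. L (frechet_derivative f (at x) v)"])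
       (use frechet_derivative_eqI[OF d] Suc in auto)
  then show ?case using d by (auto simp: differentiable_def)
qed

lemma smooth_on_bounded_linear:
  "bounded_linear L \<Longrightarrow> open S \<Longrightarrow> smooth_on S f \<Longrightarrow> smooth_on S (\<lambda>x. L (f x))"
  by (simp add: smooth_on_def Ck_on_bounded_linear)

lemma Ck_on_add:
  assumes S: "open S"
  shows "Ck_on k S f \<Longrightarrow> Ck_on k S g \<Longrightarrow> Ck_on k S (\<lambda>x. f x + g x)"
proof (induction k arbitrary: f g)
  case 0
  then show ?case by (auto intro: continuous_on_add)
next
  case (Suc k)
  have d: "((\<lambda>x. f x + g x) has_derivative
      (\<lambda>v. frechet_derivative f (at x) v + frechet_derivative g (at x) v)) (at x)" if "x \<in> S" for x
    using Suc.prems that by (auto simp: frechet_derivative_works intro!: has_derivative_add)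
  have "Ck_on k S (\<lambda>x. frechet_derivative (\<lambda>x. f x + g x) (at x) v)" for v
    by (rule Ck_on_cong[OF S, of "\<lambda>x. frechet_derivative f (at x) v + frechet_derivative g (at x) v"])
       (use frechet_derivative_eqI[OF d] Suc in auto)
  then show ?case using d by (auto simp: differentiable_def)
qed

lemma smooth_on_add:
  "open S \<Longrightarrow> smooth_on S f \<Longrightarrow> smooth_on S g \<Longrightarrow> smooth_on S (\<lambda>x. f x + g x)"
  by (simp add: smooth_on_def Ck_on_add)

lemma smooth_on_diff:
  assumes "open S" "smooth_on S f" "smooth_on S g" shows "smooth_on S (\<lambda>x. f x - g x)"
  using smooth_on_add[OF assms(1,2) smooth_on_bounded_linear[OF _ assms(1,3), of uminus]]
  by (simp add: bounded_linear_minus bounded_linear_ident)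

lemma smooth_on_sum:
  "open S \<Longrightarrow> (\<And>j. j \<in> I \<Longrightarrow> smooth_on S (f j)) \<Longrightarrow> smooth_on S (\<lambda>x. \<Sum>j\<in>I. f j x)"
  by (induction I rule: infinite_finite_induct) (auto intro: smooth_on_const smooth_on_add)

lemma Ck_on_bilinear:
  assumes B: "bounded_bilinear B" and S: "open S"
  shows "Ck_on k S f \<Longrightarrow> Ck_on k S g \<Longrightarrow> Ck_on k S (\<lambda>x. B (f x) (g x))"
proof (induction k arbitrary: f g)
  case 0
  then show ?case by (auto intro: bounded_bilinear.continuous_on[OF B])
next
  case (Suc k)
  have d: "((\<lambda>x. B (f x) (g x)) has_derivative
      (\<lambda>v. B (f x) (frechet_derivative g (at x) v) + B (frechet_derivative f (at x) v) (g x))) (at x)"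
    if "x \<in> S" for x
    using Suc.prems that by (auto simp: frechet_derivative_works intro!: bounded_bilinear.FDERIV[OF B])
  \<comment> \<open>The product rule mixes derivatives with the undifferentiated factors, so those
    are needed at order \<open>k\<close> as well.\<close>
  note fg = Suc.prems[THEN Ck_on_mono]
  have "Ck_on k S (\<lambda>x. frechet_derivative f (at x) v)" "Ck_on k S (\<lambda>x. frechet_derivative g (at x) v)" for v
    using Suc.prems by auto
  then have e: "Ck_on k S (\<lambda>x. B (f x) (frechet_derivative g (at x) v) + B (frechet_derivative f (at x) v) (g x))" for v
    by (intro Ck_on_add[OF S] Suc.IH fg)
  have "Ck_on k S (\<lambda>x. frechet_derivative (\<lambda>x. B (f x) (g x)) (at x) v)" for v
    by (rule Ck_on_cong[OF S, of "\<lambda>x. B (f x) (frechet_derivative g (at x) v) + B (frechet_derivative f (at x) v) (g x)"])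
       (use frechet_derivative_eqI[OF d] e in auto)
  then show ?case using d by (auto simp: differentiable_def)
qed

lemma smooth_on_bilinear:
  "bounded_bilinear B \<Longrightarrow> open S \<Longrightarrow> smooth_on S f \<Longrightarrow> smooth_on S g \<Longrightarrow> smooth_on S (\<lambda>x. B (f x) (g x))"
  by (simp add: smooth_on_def Ck_on_bilinear)

text \<open>Differentiate \<open>f (p + s u + t v) - f (p + s u) = \<integral>\<^sub>0\<^sup>t (\<partial>\<^sub>v f) (p + s u + \<tau> v) d\<tau>\<close> under the
  integral sign in \<open>s\<close>, then in \<open>t\<close>.\<close>
lemma smooth_on_dd_commute:
  fixes f :: "'a::real_normed_vector \<Rightarrow> 'b::euclidean_space"
  assumes S: "open S" and f: "smooth_on S f" and p: "p \<in> S"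
  shows "frechet_derivative (\<lambda>x. frechet_derivative f (at x) u) (at p) v =
         frechet_derivative (\<lambda>x. frechet_derivative f (at x) v) (at p) u"
proof -
  define fu where "fu = (\<lambda>x. frechet_derivative f (at x) u)"
  define fv where "fv = (\<lambda>x. frechet_derivative f (at x) v)"
  define fvu where "fvu = (\<lambda>x. frechet_derivative fv (at x) u)"
  have sfu: "smooth_on S fu" and sfv: "smooth_on S fv" and sfvu: "smooth_on S fvu"
    unfolding fu_def fv_def fvu_def by (intro smooth_on_dd f)+
  obtain r where r: "r > 0" "ball p r \<subseteq> S" using S p openE by blast
  \<comment> \<open>The summand \<open>1\<close> keeps \<open>N\<close> positive even for
    \<open>u = v = 0\<close>; with \<open>d = r / (2 * N)\<close> the whole parallelogram stays in
    \<open>ball p r\<close>.\<close>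
  define N where "N = norm u + norm v + 1"
  have nn: "N > 0" unfolding N_def by (smt (verit) norm_ge_zero)
  define d where "d = r / (2 * N)"
  have d: "d > 0" unfolding d_def using r(1) nn by simp
  have inS: "p + s *\<^sub>R u + t *\<^sub>R v \<in> S" if "\<bar>s\<bar> \<le> d" "\<bar>t\<bar> \<le> d" for s t
  proof -
    have "norm (s *\<^sub>R u + t *\<^sub>R v) \<le> \<bar>s\<bar> * norm u + \<bar>t\<bar> * norm v"
      by (metis norm_scaleR norm_triangle_ineq)
    also have "\<dots> \<le> d * norm u + d * norm v" using that by (intro add_mono mult_right_mono) auto
    also have "\<dots> \<le> d * N" using d by (simp add: N_def algebra_simps)
    also have "\<dots> = r / 2" unfolding d_def using nn by simp
    finally have "norm (s *\<^sub>R u + t *\<^sub>R v) < r" using r(1) by simp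
    then have "p + (s *\<^sub>R u + t *\<^sub>R v) \<in> ball p r"
      unfolding mem_ball dist_norm by (metis add_diff_cancel_left' norm_minus_commute)
    then show ?thesis using r(2) by (auto simp: add.assoc)
  qed
  have line: "((\<lambda>t. g (q + t *\<^sub>R w)) has_vector_derivative frechet_derivative g (at (q + t *\<^sub>R w)) w) (at t within I)"
    if "smooth_on S g" "q + t *\<^sub>R w \<in> S" for g :: "'a \<Rightarrow> 'b" and q w t I
  proof -
    have 1: "((\<lambda>t. q + t *\<^sub>R w) has_derivative (\<lambda>h. h *\<^sub>R w)) (at t within I)"
      by (auto intro!: derivative_eq_intros)
    have gd: "(g has_derivative frechet_derivative g (at (q + t *\<^sub>R w))) (at (q + t *\<^sub>R w))"
      using smooth_on_has_derivative that by blast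
    have 2: "((\<lambda>t. g (q + t *\<^sub>R w)) has_derivative (\<lambda>h. frechet_derivative g (at (q + t *\<^sub>R w)) (h *\<^sub>R w))) (at t within I)"
      using has_derivative_compose[OF 1 gd] .
    show ?thesis unfolding has_vector_derivative_def
      using 2 linear_scale[OF has_derivative_linear[OF gd]] by simp
  qed
  have cont: "continuous_on T (\<lambda>x. g (k x))" if "smooth_on S g" "continuous_on T k" "k ` T \<subseteq> S"
    for g :: "'a \<Rightarrow> 'b" and k :: "'c::topological_space \<Rightarrow> 'a" and T
    using continuous_on_compose2[OF smooth_on_continuous[OF that(1)] that(2,3)] .
  define I where "I = (\<lambda>t s. integral {0..t} (\<lambda>\<tau>. fv (p + s *\<^sub>R u + \<tau> *\<^sub>R v)))"
  have I1: "I t s = f (p + s *\<^sub>R u + t *\<^sub>R v) - f (p + s *\<^sub>R u)" if "\<bar>s\<bar> \<le> d" "0 \<le> t" "t \<le> d" for s t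
  proof -
    have "((\<lambda>\<tau>. fv (p + s *\<^sub>R u + \<tau> *\<^sub>R v)) has_integral
        (f (p + s *\<^sub>R u + t *\<^sub>R v) - f (p + s *\<^sub>R u + 0 *\<^sub>R v))) {0..t}"
      using that by (intro fundamental_theorem_of_calculus) (auto simp: fv_def intro!: line[OF f] inS)
    then show ?thesis unfolding I_def by (simp add: integral_unique)
  qed
  \<comment> \<open>The derivative of \<open>I t\<close> at \<open>0\<close> is computed twice:
    under the integral sign, and from the increment of \<open>f\<close> in
    \<open>I1\<close>.\<close>
  have main: "fu (p + t *\<^sub>R v) - fu p = integral {0..t} (\<lambda>\<tau>. fvu (p + \<tau> *\<^sub>R v))" if t: "0 \<le> t" "t \<le> d" for t
  proof -
    have "(I t has_vector_derivative integral (cbox 0 t) (\<lambda>\<tau>. fvu (p + 0 *\<^sub>R u + \<tau> *\<^sub>R v))) (at 0 within {-d<..<d})"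
      unfolding I_def cbox_interval[symmetric]
    proof (rule leibniz_rule_vector_derivative)
      fix s \<tau> assume "s \<in> {-d<..<d}" "\<tau> \<in> cbox 0 t"
      then have "p + s *\<^sub>R u + \<tau> *\<^sub>R v \<in> S" using t by (intro inS) auto
      then show "((\<lambda>s. fv (p + s *\<^sub>R u + \<tau> *\<^sub>R v)) has_vector_derivative fvu (p + s *\<^sub>R u + \<tau> *\<^sub>R v)) (at s within {-d<..<d})"
        using line[OF sfv, of "p + \<tau> *\<^sub>R v" s u "{-d<..<d}"] by (simp add: fvu_def algebra_simps)
    next
      fix s assume "s \<in> {-d<..<d}"
      then show "(\<lambda>\<tau>. fv (p + s *\<^sub>R u + \<tau> *\<^sub>R v)) integrable_on cbox 0 t"
        using t by (intro integrable_continuous cont[OF sfv]) (auto intro!: inS continuous_intros)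
    next
      show "continuous_on ({-d<..<d} \<times> cbox 0 t) (\<lambda>(s, \<tau>). fvu (p + s *\<^sub>R u + \<tau> *\<^sub>R v))"
        unfolding split_beta using t
        by (intro cont[OF sfvu]) (auto intro!: inS continuous_intros)
    qed (use d in auto)
    then have "(I t has_vector_derivative integral {0..t} (\<lambda>\<tau>. fvu (p + \<tau> *\<^sub>R v))) (at 0)"
      using d by (simp add: at_within_open[of 0 "{-d<..<d}"])
    moreover have "(I t has_vector_derivative fu (p + t *\<^sub>R v) - fu p) (at 0)"
    proof (rule has_vector_derivative_transform_within_open[of _ _ _ "{-d<..<d}"])
      have "p + t *\<^sub>R v \<in> S" using inS[of 0 t] t d by simp
      then show "((\<lambda>s. f (p + t *\<^sub>R v + s *\<^sub>R u) - f (p + s *\<^sub>R u)) has_vector_derivative fu (p + t *\<^sub>R v) - fu p) (at 0)"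
        using line[OF f, of "p + t *\<^sub>R v" 0 u UNIV] line[OF f, of p 0 u UNIV] p
        by (auto simp: fu_def intro!: has_vector_derivative_diff)
      show "f (p + t *\<^sub>R v + s *\<^sub>R u) - f (p + s *\<^sub>R u) = I t s" if "s \<in> {-d<..<d}" for s
        using I1[of s t] t that by (simp add: abs_le_iff algebra_simps)
    qed (use d in auto)
    ultimately show ?thesis by (rule vector_derivative_unique_at[symmetric])
  qed
  \<comment> \<open>\<open>main\<close> is available for \<open>t \<ge> 0\<close>, so both sides are
    compared through one-sided derivatives at \<open>0\<close>.\<close>
  have "((\<lambda>t. integral {0..t} (\<lambda>\<tau>. fvu (p + \<tau> *\<^sub>R v))) has_vector_derivative fvu (p + 0 *\<^sub>R v)) (at 0 within {0..d})"
    using d inS[of 0] by (intro integral_has_vector_derivative cont[OF sfvu]) (auto intro!: continuous_intros)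
  then have "((\<lambda>t. fu (p + t *\<^sub>R v) - fu p) has_vector_derivative fvu p) (at 0 within {0..d})"
    using main d by (auto elim!: has_vector_derivative_transform[rotated 2])
  moreover have "((\<lambda>t. fu (p + t *\<^sub>R v) - fu p) has_vector_derivative frechet_derivative fu (at p) v) (at 0 within {0..d})"
    using line[OF sfu, of p 0 v "{0..d}"] p by (auto intro!: derivative_eq_intros)
  ultimately have "fvu p = frechet_derivative fu (at p) v"
    using d by (intro vector_derivative_unique_within) (auto simp: trivial_limit_within islimpt_Icc)
  then show ?thesis by (simp add: fu_def fv_def fvu_def)
qed

section \<open>Lie algebras with a Cartan involution\<close>

text \<open>Links the real scaling used by derivatives with the complex scaling used by the Lie
  algebra.\<close>

lemma scaleR_eq_of_real_vec: "r *\<^sub>R (x :: complex^'n) = complex_of_real r *s x"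
  unfolding vec_eq_iff vector_scaleR_component vector_smult_component
  by (intro allI scaleR_conv_of_real)

lemma matrix_diff_ldistrib: "A ** (B - C) = A ** B - A ** (C :: 'a::ring_1^'n^'m)"
  and matrix_diff_rdistrib: "(B - C) ** (D :: 'a::ring_1^'k^'n) = B ** D - C ** D"
  by (simp_all add: matrix_matrix_mult_def vec_eq_iff right_diff_distrib left_diff_distrib sum_subtractf)

section \<open>Bracket calculus in a complex Lie algebra\<close>

locale lie_alg =
  fixes br :: "complex^'n \<Rightarrow> complex^'n \<Rightarrow> complex^'n"
  assumes lie: "lie_algebra br"
begin

lemma linear_br: "Vector_Spaces.linear (*s) (*s) (br x)"
  and linear_br_left: "Vector_Spaces.linear (*s) (*s) (\<lambda>x. br x y)"
  using lie unfolding lie_algebra_def by blast+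

lemma br_add_right: "br x (y + z) = br x y + br x z"
  and br_scale_right: "br x (c *s y) = c *s br x y"
  using linear_br[of x] by (auto simp: Vector_Spaces.linear_iff)

lemma br_add_left: "br (x + y) z = br x z + br y z"
  and br_scale_left: "br (c *s x) z = c *s br x z"
  using linear_br_left[of z] by (auto simp: Vector_Spaces.linear_iff)

lemma br_zero_right [simp]: "br x 0 = 0"
  and br_zero_left [simp]: "br 0 x = 0"
  using br_scale_right[of x 0 0] br_scale_left[of 0 0 x] by simp_all

lemma br_minus_right: "br x (- y) = - br x y"
  and br_minus_left: "br (- x) y = - br x y"
  using br_scale_right[of x "-1" y] br_scale_left[of "-1" x y] by (simp_all add: vector_smult_lneg)

lemma br_diff_right: "br x (y - z) = br x y - br x z"
  and br_diff_left: "br (x - y) z = br x z - br y z"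
  using br_add_right[of x y "-z"] br_add_left[of x "-y" z] by (simp_all add: br_minus_right br_minus_left)

lemma br_self [simp]: "br x x = 0"
  using lie unfolding lie_algebra_def by blast

lemma br_commute: "br x y = - br y x"
proof -
  have "br x y + br y x = 0"
    using br_self[of "x + y"] unfolding br_add_left br_add_right by (simp add: add.commute)
  then show ?thesis by (simp add: eq_neg_iff_add_eq_0)
qed

lemma br_jacobi: "br x (br y z) = br (br x y) z + br y (br x z)"
proof -
  have "br x (br y z) + br y (br z x) + br z (br x y) = 0"
    using lie unfolding lie_algebra_def by blast
  moreover have "br y (br z x) = - br y (br x z)" "br z (br x y) = - br (br x y) z"
    using br_commute[of z x] br_commute[of z "br x y"] by (simp_all add: br_minus_right)
  ultimately show ?thesis by (simp add: algebra_simps)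
qed

lemma br_sum_right: "br x (\<Sum>i\<in>I. f i) = (\<Sum>i\<in>I. br x (f i))"
  by (induction I rule: infinite_finite_induct) (auto simp: br_add_right)

lemma br_scaleR_left: "br (r *\<^sub>R x) y = r *\<^sub>R br x y"
  and br_scaleR_right: "br x (r *\<^sub>R y) = r *\<^sub>R br x y"
  by (simp_all add: scaleR_eq_of_real_vec br_scale_left br_scale_right)

lemma bounded_bilinear_br: "bounded_bilinear br"
proof -
  have "bilinear br"
    by (auto simp: bilinear_def linear_iff br_add_left br_add_right br_scaleR_left br_scaleR_right)
  then show ?thesis by (simp add: bilinear_conv_bounded_bilinear)
qed

section \<open>The Killing form and its invariance\<close>

abbreviation \<kappa> where "\<kappa> \<equiv> killing_form br"

abbreviation ad where "ad x \<equiv> matrix (br x)"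

text \<open>In standard coordinates additivity and homogeneity can be read off; the trace of a
  matrix product, next, serves symmetry and invariance.\<close>

lemma killing_form_eq_sum: "\<kappa> x y = (\<Sum>i\<in>UNIV. br x (br y (axis i 1)) $ i)"
  by (simp add: killing_form_def trace_def matrix_def)

lemma killing_form_eq_trace: "\<kappa> x y = trace (ad x ** ad y)"
  using matrix_compose_gen[OF linear_br[of y] linear_br[of x]]
  by (simp add: killing_form_def o_def)

lemma killing_form_commute: "\<kappa> x y = \<kappa> y x"
  by (simp add: killing_form_eq_trace trace_mul_sym[of "ad x"])

lemma killing_form_add_left: "\<kappa> (x + y) z = \<kappa> x z + \<kappa> y z"
  by (simp add: killing_form_eq_sum br_add_left sum.distrib)

lemma killing_form_scale_left: "\<kappa> (c *s x) z = c * \<kappa> x z"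
  by (simp add: killing_form_eq_sum br_scale_left sum_distrib_left)

lemma killing_form_add_right: "\<kappa> x (y + z) = \<kappa> x y + \<kappa> x z"
  and killing_form_scale_right: "\<kappa> x (c *s y) = c * \<kappa> x y"
  using killing_form_add_left[of y z x] killing_form_scale_left[of c y x]
  by (simp_all add: killing_form_commute)

lemma killing_form_zero_left [simp]: "\<kappa> 0 x = 0"
  and killing_form_zero_right [simp]: "\<kappa> x 0 = 0"
  by (simp_all add: killing_form_eq_sum)

lemma killing_form_minus_left: "\<kappa> (- x) y = - \<kappa> x y"
  and killing_form_minus_right: "\<kappa> x (- y) = - \<kappa> x y"
  by (simp_all add: killing_form_eq_sum br_minus_left br_minus_right sum_negf)

lemma killing_form_diff_left: "\<kappa> (x - y) z = \<kappa> x z - \<kappa> y z"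
  using killing_form_add_left[of x "-y" z] by (simp add: killing_form_minus_left)

lemma bounded_bilinear_killing_form: "bounded_bilinear \<kappa>"
proof -
  have "bilinear \<kappa>"
    by (auto simp: bilinear_def linear_iff killing_form_add_left killing_form_add_right
        scaleR_eq_of_real_vec killing_form_scale_left killing_form_scale_right scaleR_conv_of_real)
  then show ?thesis by (simp add: bilinear_conv_bounded_bilinear)
qed

text \<open>The Leibniz rule, read as an identity of operators acting on \<open>y\<close>. For
  \<open>D = br x\<close> it is the Jacobi identity.\<close>

lemma matrix_commutator:
  assumes D: "Vector_Spaces.linear (*s) (*s) D"
    and der: "\<And>x y. D (br x y) = br (D x) y + br x (D y)"
  shows "ad (D x) = matrix D ** ad x - ad x ** matrix D"
proof -
  have "matrix D ** ad x = matrix (D \<circ> br x)" "ad x ** matrix D = matrix (br x \<circ> D)"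
    using matrix_compose_gen[OF linear_br[of x] D] matrix_compose_gen[OF D linear_br[of x]] by simp_all
  then show ?thesis by (simp add: vec_eq_iff matrix_def der)
qed

lemma ad_br: "ad (br x y) = ad x ** ad y - ad y ** ad x"
  using matrix_commutator[OF linear_br br_jacobi] .

text \<open>After expanding both inner brackets as commutators of matrices, the two terms that
  differ are equal by cyclicity of the trace.\<close>

lemma killing_form_invariant: "\<kappa> (br x y) z = \<kappa> x (br y z)"
proof -
  have "trace (ad y ** (ad x ** ad z)) = trace ((ad x ** ad z) ** ad y)" by (rule trace_mul_sym)
  then show ?thesis
    by (simp add: killing_form_eq_trace ad_br matrix_diff_rdistrib matrix_diff_ldistrib
        trace_sub matrix_mul_assoc)
qed

end

section \<open>Cartan involutions: positivity, adjoints, inner derivations\<close>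

locale cartan_lie_alg = lie_alg br for br :: "complex^'n \<Rightarrow> complex^'n \<Rightarrow> complex^'n" +
  fixes \<rho> :: "complex^'n \<Rightarrow> complex^'n"
  assumes cartan: "cartan_involution br \<rho>"
begin

lemma rho_add: "\<rho> (x + y) = \<rho> x + \<rho> y"
  and rho_scale: "\<rho> (c *s x) = cnj c *s \<rho> x"
  and rho_rho [simp]: "\<rho> (\<rho> x) = x"
  and rho_br: "\<rho> (br x y) = br (\<rho> x) (\<rho> y)"
  and killing_form_rho_neg: "x \<noteq> 0 \<Longrightarrow> Re (\<kappa> x (\<rho> x)) < 0"
  using cartan by (auto simp: cartan_involution_def)

lemma rho_zero [simp]: "\<rho> 0 = 0"
  using rho_scale[of 0 0] by simp

lemma rho_minus: "\<rho> (- x) = - \<rho> x"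
  using rho_scale[of "-1" x] by (simp add: vector_smult_lneg)

text \<open>Positive definiteness of the hermitian form \<open>- \<kappa> x (\<rho> y)\<close>, in
  the shape in which vectors are shown to vanish below.\<close>

lemma eq_zero_if_killing_form_rho: "Re (\<kappa> x (\<rho> x)) \<ge> 0 \<Longrightarrow> x = 0"
  using killing_form_rho_neg[of x] by force

lemma killing_form_nondegenerate: "(\<And>y. \<kappa> x y = 0) \<Longrightarrow> x = 0"
  using eq_zero_if_killing_form_rho[of x] by simp

text \<open>If \<open>br x\<close> vanishes, then so does the functional \<open>\<kappa> x\<close>,
  and the form is nondegenerate.\<close>

lemma center_trivial: "(\<And>y. br x y = 0) \<Longrightarrow> x = 0"
  by (rule killing_form_nondegenerate) (simp add: killing_form_eq_sum)

lemma br_left_eqD: "(\<And>z. br x z = br y z) \<Longrightarrow> x = y"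
  using center_trivial[of "x - y"] by (simp add: br_diff_left)

text \<open>For the hermitian form \<open>- \<kappa> x (\<rho> y)\<close> the adjoint of
  \<open>br x\<close> is \<open>br (- \<rho> x)\<close>; here \<open>x'\<close> names that
  element.\<close>

lemma killing_form_adjoint: "\<rho> x = - x' \<Longrightarrow> \<kappa> (br x y) (\<rho> z) = \<kappa> y (\<rho> (br x' z))"
proof -
  assume x: "\<rho> x = - x'"
  then have "x = - \<rho> x'" using rho_rho[of x] by (simp add: rho_minus)
  moreover have "\<kappa> (br x y) (\<rho> z) = - \<kappa> y (br x (\<rho> z))"
    using br_commute[of x y] by (simp add: killing_form_minus_left killing_form_invariant)
  ultimately show ?thesis by (simp add: rho_br br_minus_left killing_form_minus_right)
qed

text \<open>With \<open>s\<close> chosen so that \<open>\<kappa> s\<close> is the functional \<open>x \<mapsto> tr (D \<circ> ad x)\<close>, the derivation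
  \<open>E = D - ad s\<close> satisfies \<open>\<kappa> (E x) y = tr (E \<circ> ad [x, y]) = 0\<close>.\<close>
lemma derivation_inner:
  assumes D: "Vector_Spaces.linear (*s) (*s) D"
    and der: "\<And>x y. D (br x y) = br (D x) y + br x (D y)"
  shows "\<exists>s. \<forall>x. D x = br s x"
proof -
  have expand: "f x = (\<Sum>i\<in>UNIV. x $ i * f (axis i 1))"
    if "\<And>x y. f (x + y) = f x + f y" "\<And>c x. f (c *s x) = c * f x" for f :: "complex^'n \<Rightarrow> complex" and x
  proof -
    have "f 0 = 0" using that(2)[of 0 0] by simp
    then have s: "f (\<Sum>i\<in>I. h i) = (\<Sum>i\<in>I. f (h i))" for I :: "'n set" and h
      by (induction I rule: infinite_finite_induct) (auto simp: that)
    have "f x = f (\<Sum>i\<in>UNIV. x $ i *s axis i 1)" by (simp only: basis_expansion)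
    then show ?thesis by (simp only: s that)
  qed
  \<comment> \<open>\<open>K s\<close> holds the coordinates of the functional
    \<open>\<kappa> s\<close>. It is injective by nondegeneracy, hence onto, so every functional is
    represented by some \<open>s\<close>.\<close>
  define K where "K s = (\<chi> i. \<kappa> s (axis i 1))" for s
  have kap: "\<kappa> s x = (\<Sum>i\<in>UNIV. x $ i * K s $ i)" for s x
    using expand[of "\<kappa> s" x] by (simp add: killing_form_add_right killing_form_scale_right K_def)
  have linK: "Vector_Spaces.linear (*s) (*s) K"
    by (auto simp: Vector_Spaces.linear_iff K_def vec_eq_iff killing_form_add_left
        killing_form_scale_left vec.vector_space_axioms)
  have "inj K"
  proof (rule injI)
    fix s t assume "K s = K t"
    then have "\<kappa> (s - t) y = 0" for y unfolding killing_form_diff_left by (simp add: kap)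
    then show "s = t" using killing_form_nondegenerate[of "s - t"] by simp
  qed
  then have "surj K" using vec.linear_inj_imp_surj[OF linK] by blast
  then obtain s where s: "K s = (\<chi> i. trace (matrix D ** ad (axis i 1)))" by (metis surjD)
  define E where "E x = D x - br s x" for x
  have linE: "Vector_Spaces.linear (*s) (*s) E"
    unfolding E_def using D linear_br[of s]
    by (auto simp: Vector_Spaces.linear_iff vector_space_over_itself.scale_right_diff_distrib
        vec.scale_right_diff_distrib)
  have derE: "E (br x y) = br (E x) y + br x (E y)" for x y
    unfolding E_def by (simp add: der br_jacobi[of s x y] br_diff_left br_diff_right)
  have matE: "matrix E = matrix D - ad s" by (simp add: matrix_def E_def vec_eq_iff)
  \<comment> \<open>By the choice of \<open>s\<close> the functionals
    \<open>trace (matrix D ** ad x)\<close> and \<open>\<kappa> s x\<close> agree on the basis,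
    hence everywhere.\<close>
  have tr0: "trace (matrix E ** ad x) = 0" for x
  proof -
    define f where "f x = trace (matrix D ** ad x)" for x
    have f: "f x = (\<Sum>i\<in>UNIV. \<Sum>k\<in>UNIV. matrix D $ i $ k * br x (axis i 1) $ k)" for x
      by (simp add: f_def trace_def matrix_matrix_mult_def matrix_def)
    have "f x = (\<Sum>i\<in>UNIV. x $ i * f (axis i 1))"
      by (rule expand) (simp_all add: f br_add_left br_scale_left distrib_left sum.distrib
          sum_distrib_left mult.left_commute)
    then have "trace (matrix D ** ad x) = (\<Sum>i\<in>UNIV. x $ i * trace (matrix D ** ad (axis i 1)))"
      by (simp add: f_def)
    also have "\<dots> = \<kappa> s x" by (simp add: kap s)
    finally show ?thesis
      by (simp add: matE matrix_diff_rdistrib trace_sub killing_form_eq_trace)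
  qed
  have "E x = 0" for x
  proof (rule killing_form_nondegenerate)
    fix y
    have "\<kappa> (E x) y = trace (matrix E ** (ad x ** ad y)) - trace (ad x ** (matrix E ** ad y))"
      by (simp add: killing_form_eq_trace matrix_commutator[OF linE derE] matrix_diff_rdistrib
          trace_sub matrix_mul_assoc)
    also have "trace (ad x ** (matrix E ** ad y)) = trace (matrix E ** (ad y ** ad x))"
      by (subst trace_mul_sym) (simp add: matrix_mul_assoc)
    also have "trace (matrix E ** (ad x ** ad y)) - \<dots> = trace (matrix E ** ad (br x y))"
      by (simp add: ad_br matrix_diff_ldistrib trace_sub)
    finally show "\<kappa> (E x) y = 0" by (simp add: tr0)
  qed
  then show ?thesis unfolding E_def by auto
qed

text \<open>As the centre is trivial, \<open>x\<close> is recovered from its brackets with the basis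
  vectors by fixed linear maps. This turns smoothness of those brackets into smoothness of the
  element itself.\<close>

lemma ad_left_inverse:
  "\<exists>L :: 'n \<Rightarrow> complex^'n \<Rightarrow> complex^'n.
     (\<forall>j. bounded_linear (L j)) \<and> (\<forall>x. (\<Sum>j\<in>UNIV. L j (br x (axis j 1))) = x)"
proof -
  define F where "F x = (\<chi> j. br x (axis j 1))" for x
  have linF: "linear F"
    by (auto simp: linear_iff F_def vec_eq_iff br_add_left br_scaleR_left)
  have "inj F"
  proof (subst linear_injective_0[OF linF], intro allI impI)
    fix x assume x: "F x = 0"
    have "br x y = 0" for y
    proof -
      have "br x y = br x (\<Sum>i\<in>UNIV. y $ i *s axis i 1)" by (simp add: basis_expansion)
      also have "\<dots> = (\<Sum>i\<in>UNIV. y $ i *s F x $ i)" by (simp add: br_sum_right br_scale_right F_def)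
      finally show ?thesis using x by simp
    qed
    then show "x = 0" by (rule center_trivial)
  qed
  then obtain g where g: "linear g" "g \<circ> F = id" using linear_injective_left_inverse[OF linF] by blast
  \<comment> \<open>\<open>g\<close> is a left inverse of the map to the list of all columns of
    \<open>ad x\<close>; \<open>L j\<close> is its restriction to the column
    \<open>j\<close>.\<close>
  define L where "L j y = g (axis j y)" for j y
  have "bounded_linear (L j)" for j
  proof -
    have "linear (\<lambda>y. g (axis j y))"
    proof (rule linear_compose[OF _ g(1), unfolded o_def])
      show "linear (\<lambda>y. axis j y :: (complex^'n)^'n)"
        by (auto simp: linear_iff axis_def vec_eq_iff)
    qed
    then show ?thesis unfolding L_def by (simp add: linear_conv_bounded_linear)
  qed
  moreover have "(\<Sum>j\<in>UNIV. L j (br x (axis j 1))) = x" for x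
  proof -
    have "F x = (\<Sum>j\<in>UNIV. axis j (br x (axis j 1)))"
      by (simp add: vec_eq_iff F_def sum_component axis_def if_distrib cong: if_cong)
    then have "g (F x) = (\<Sum>j\<in>UNIV. L j (br x (axis j 1)))"
      by (simp add: L_def linear_sum[OF g(1)])
    then show ?thesis using g(2) by (metis comp_apply id_apply)
  qed
  ultimately show ?thesis by blast
qed

end

section \<open>Principal subalgebras\<close>

lemma (in lie_alg) span_br_invariant:
  assumes "\<And>u. u \<in> U \<Longrightarrow> br y u \<in> vec.span U" and "v \<in> vec.span U"
  shows "br y v \<in> vec.span U"
  using assms(2)
proof (induction rule: vec.span_induct_alt)
  case base
  then show ?case by (simp add: vec.span_zero)
next
  case (step c x y')
  then show ?case using assms(1) by (simp add: br_add_right br_scale_right vec.span_add vec.span_scale)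
qed

locale principal_lie_alg = lie_alg br
  for br :: "complex^'n \<Rightarrow> complex^'n \<Rightarrow> complex^'n" +
  fixes a X0 Y0 :: "complex^'n" and V :: "nat \<Rightarrow> (complex^'n) set" and m :: "nat \<Rightarrow> nat"
    and e :: "nat \<Rightarrow> complex^'n"
  assumes aX: "br a X0 = X0" and aY: "br a Y0 = - Y0" and XY: "br X0 Y0 = - a"
    and decomp: "exponent_decomposition br a X0 Y0 V m"
    and e_in: "k \<in> {1..lie_rank br} \<Longrightarrow> e k \<in> V k"
    and ae: "k \<in> {1..lie_rank br} \<Longrightarrow> br a (e k) = of_nat (m k) *s e k"
    and Xe: "k \<in> {1..lie_rank br} \<Longrightarrow> br X0 (e k) = 0"
    and e_nonzero: "k \<in> {1..lie_rank br} \<Longrightarrow> e k \<noteq> 0"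
begin

text \<open>The lowering string through the highest weight vector \<open>e k\<close>. No bound is
  put on \<open>j\<close>, so the span of the string is visibly stable under \<open>br Y0\<close>
  and its length need not be determined.\<close>

definition weight_vec :: "nat \<Rightarrow> nat \<Rightarrow> complex^'n" where
  "weight_vec k j = (br Y0 ^^ j) (e k)"

lemma weight_vec_0: "weight_vec k 0 = e k"
  and weight_vec_Suc: "weight_vec k (Suc j) = br Y0 (weight_vec k j)"
  by (simp_all add: weight_vec_def)

lemma br_a_weight_vec:
  assumes "k \<in> {1..lie_rank br}"
  shows "br a (weight_vec k j) = (of_nat (m k) - of_nat j) *s weight_vec k j"
proof (induction j)
  case 0
  then show ?case using ae[OF assms] by (simp add: weight_vec_0)
next
  case (Suc j)
  have "br a (weight_vec k (Suc j)) =
      - br Y0 (weight_vec k j) + (of_nat (m k) - of_nat j) *s br Y0 (weight_vec k j)"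
    by (simp only: weight_vec_Suc br_jacobi[of a Y0] aY br_minus_left Suc.IH br_scale_right)
  then show ?case by (simp add: weight_vec_Suc vec_eq_iff algebra_simps)
qed

lemma weight_vec_grading:
  "k \<in> {1..lie_rank br} \<Longrightarrow> weight_vec k j \<in> grading br a (int (m k) - int j)"
  by (simp add: grading_def br_a_weight_vec)

text \<open>The span of the string is stable under the principal triple, lies in \<open>V k\<close>
  and contains \<open>e k \<noteq> 0\<close>; irreducibility leaves no other possibility.\<close>

lemma V_eq_span:
  assumes k: "k \<in> {1..lie_rank br}"
  shows "V k = vec.span (range (weight_vec k))"
proof -
  have V: "irreducible_submodule br {a, X0, Y0} (V k)"
    using decomp k by (auto simp: exponent_decomposition_def)
  let ?W = "range (weight_vec k)"
  have Y: "br Y0 u \<in> vec.span ?W" if "u \<in> vec.span ?W" for u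
    by (rule span_br_invariant[OF _ that]) (auto simp: weight_vec_Suc[symmetric] intro: vec.span_base)
  have A: "br a u \<in> vec.span ?W" if "u \<in> vec.span ?W" for u
  proof (rule span_br_invariant[OF _ that])
    fix u assume "u \<in> ?W"
    then obtain j where u: "u = weight_vec k j" by blast
    show "br a u \<in> vec.span ?W"
      unfolding u br_a_weight_vec[OF k] by (intro vec.span_scale vec.span_base rangeI)
  qed
  \<comment> \<open>Moving \<open>X0\<close> past one \<open>Y0\<close> costs a term in
    \<open>a\<close>, which acts by a scalar on the string; the induction starts from
    \<open>br X0 (e k) = 0\<close>.\<close>
  have X': "br X0 (weight_vec k j) \<in> vec.span ?W" for j
  proof (induction j)
    case 0
    then show ?case by (simp add: weight_vec_0 Xe[OF k] vec.span_zero)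
  next
    case (Suc j)
    have "br X0 (weight_vec k (Suc j)) = br Y0 (br X0 (weight_vec k j)) - br a (weight_vec k j)"
      by (simp add: weight_vec_Suc br_jacobi[of X0] XY br_minus_left)
    then show ?case using Y[OF Suc] A[of "weight_vec k j"] by (auto intro: vec.span_diff vec.span_base)
  qed
  have X: "br X0 u \<in> vec.span ?W" if "u \<in> vec.span ?W" for u
    by (rule span_br_invariant[OF _ that]) (use X' in auto)
  have sub: "vec.subspace (V k)" and Y0V: "br Y0 ` V k \<subseteq> V k"
    and irr: "\<And>U. vec.subspace U \<Longrightarrow> U \<subseteq> V k \<Longrightarrow> (\<And>s. s \<in> {a, X0, Y0} \<Longrightarrow> br s ` U \<subseteq> U) \<Longrightarrow> U = {0} \<or> U = V k"
    using V unfolding irreducible_submodule_def by blast+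
  have "weight_vec k j \<in> V k" for j
    by (induction j) (use e_in[OF k] Y0V in \<open>auto simp: weight_vec_0 weight_vec_Suc\<close>)
  then have "vec.span ?W \<subseteq> V k" by (intro vec.span_minimal sub) auto
  moreover have "vec.span ?W \<noteq> {0}"
    using e_nonzero[OF k] vec.span_base[OF rangeI, of "weight_vec k" 0] by (auto simp: weight_vec_0)
  ultimately show ?thesis using irr[of "vec.span ?W"] A X Y by auto
qed

lemma span_weight_vec: "v \<in> vec.span (\<Union>k\<in>{1..lie_rank br}. range (weight_vec k))"
proof -
  obtain u where u: "\<And>k. k \<in> {1..lie_rank br} \<Longrightarrow> u k \<in> V k" "v = (\<Sum>k=1..lie_rank br. u k)"
    using decomp unfolding exponent_decomposition_def by blast
  have "u k \<in> vec.span (\<Union>k\<in>{1..lie_rank br}. range (weight_vec k))" if "k \<in> {1..lie_rank br}" for k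
  proof -
    have "vec.span (range (weight_vec k)) \<subseteq> vec.span (\<Union>k\<in>{1..lie_rank br}. range (weight_vec k))"
      by (rule vec.span_mono) (use that in blast)
    then show ?thesis using u(1)[OF that] V_eq_span[OF that] by blast
  qed
  then show ?thesis unfolding u(2) by (rule vec.span_sum)
qed

lemma subspace_grading: "vec.subspace (grading br a n)"
  by (auto simp: vec.subspace_def grading_def br_add_right br_scale_right vector_add_ldistrib
      vector_smult_assoc mult.commute)

text \<open>The weight vectors span and have integral weights. Allowing every finite
  \<open>U\<close> above \<open>S\<close> lets two vectors be expanded over a common index
  set.\<close>

lemma graded_decomposition:
  "\<exists>S f. finite S \<and> (\<forall>n. f n \<in> grading br a n) \<and> (\<forall>U. finite U \<longrightarrow> S \<subseteq> U \<longrightarrow> v = sum f U)"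
  using span_weight_vec[of v]
proof (induction rule: vec.span_induct_alt)
  case base
  then show ?case
    by (intro exI[of _ "{}"] exI[of _ "\<lambda>n. 0"]) (auto simp: vec.subspace_0[OF subspace_grading])
next
  case (step c x y)
  then obtain k j where k: "k \<in> {1..lie_rank br}" and x: "x = weight_vec k j" by auto
  from step obtain S f where f: "finite S" "\<And>n. f n \<in> grading br a n"
      "\<And>U. finite U \<Longrightarrow> S \<subseteq> U \<Longrightarrow> y = sum f U" by blast
  define d where "d = int (m k) - int j"
  define f' where "f' n = (if n = d then c *s x else 0) + f n" for n
  have "f' n \<in> grading br a n" for n
    unfolding f'_def using weight_vec_grading[OF k, of j]
    by (intro vec.subspace_add[OF subspace_grading])
       (auto simp: f x d_def intro!: vec.subspace_scale[OF subspace_grading] vec.subspace_0[OF subspace_grading])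
  moreover have "c *s x + y = sum f' U" if "finite U" "insert d S \<subseteq> U" for U
    using that f(3)[of U] by (simp add: f'_def sum.distrib)
  ultimately show ?case using f(1)
    by (intro exI[of _ "insert d S"] exI[of _ f'] conjI allI impI) simp_all
qed

text \<open>\<open>graded_map\<close> prescribes \<open>T\<close> on finite sums of homogeneous
  vectors, and by \<open>graded_decomposition\<close> every vector is such a sum.\<close>

lemma graded_map_linear:
  assumes "graded_map br a (\<lambda>n v. (c powi n) *s v) T"
  shows "Vector_Spaces.linear (*s) (*s) T"
proof -
  have T: "T (sum f U) = (\<Sum>n\<in>U. (c powi n) *s f n)" if "finite U" "\<And>n. f n \<in> grading br a n" for f U
    using assms that by (simp add: graded_map_def)
  have "T (x + y) = T x + T y" for x y
  proof -
    obtain S f where f: "finite S" "\<And>n. f n \<in> grading br a n" "\<And>U. finite U \<Longrightarrow> S \<subseteq> U \<Longrightarrow> x = sum f U"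
      using graded_decomposition[of x] by metis
    obtain S' g where g: "finite S'" "\<And>n. g n \<in> grading br a n" "\<And>U. finite U \<Longrightarrow> S' \<subseteq> U \<Longrightarrow> y = sum g U"
      using graded_decomposition[of y] by metis
    let ?U = "S \<union> S'"
    have U: "finite ?U" using f(1) g(1) by simp
    have x: "x = sum f ?U" and y: "y = sum g ?U" using f(3)[OF U] g(3)[OF U] by auto
    have "x + y = (\<Sum>n\<in>?U. f n + g n)" by (subst x, subst y) (simp add: sum.distrib)
    then have "T (x + y) = (\<Sum>n\<in>?U. (c powi n) *s (f n + g n))"
      using T[OF U, of "\<lambda>n. f n + g n"] f(2) g(2) vec.subspace_add[OF subspace_grading] by simp
    also have "\<dots> = T (sum f ?U) + T (sum g ?U)"
      using T[OF U, of f] T[OF U, of g] f(2) g(2) by (simp add: vector_add_ldistrib sum.distrib)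
    finally show ?thesis using x y by simp
  qed
  moreover have "T (r *s x) = r *s T x" for r x
  proof -
    obtain S f where f: "finite S" "\<And>n. f n \<in> grading br a n" "x = sum f S"
      using graded_decomposition[of x] by blast
    have "r *s x = (\<Sum>n\<in>S. r *s f n)" unfolding f(3) by (rule vec.scale_sum_right)
    then have "T (r *s x) = (\<Sum>n\<in>S. (c powi n) *s (r *s f n))"
      using T[OF f(1), of "\<lambda>n. r *s f n"] f(2) vec.subspace_scale[OF subspace_grading] by simp
    also have "\<dots> = r *s T x"
      unfolding f(3) T[OF f(1,2)] vec.scale_sum_right by (simp add: vector_smult_assoc mult.commute)
    finally show ?thesis .
  qed
  ultimately show ?thesis by (simp add: Vector_Spaces.linear_iff vec.vector_space_axioms)
qed

lemma graded_map_surj: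
  assumes T: "graded_map br a (\<lambda>n v. (c powi n) *s v) T" and c: "c \<noteq> 0"
  shows "surj T"
proof (rule surjI)
  fix y
  obtain S f where f: "finite S" "\<And>n. f n \<in> grading br a n" "y = sum f S"
    using graded_decomposition[of y] by blast
  \<comment> \<open>The preimage of \<open>y\<close> rescales its component of degree
    \<open>n\<close> by the inverse of the factor that \<open>T\<close> applies.\<close>
  have "T (\<Sum>n\<in>S. (c powi (- n)) *s f n) = (\<Sum>n\<in>S. (c powi n) *s ((c powi (- n)) *s f n))"
    using T f(1,2) vec.subspace_scale[OF subspace_grading] by (simp add: graded_map_def)
  also have "\<dots> = y" using c by (simp add: f(3) vector_smult_assoc power_int_minus)
  finally have "\<exists>x. T x = y" by blast
  then show "T (SOME x. T x = y) = y" by (rule someI_ex)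
qed

end

section \<open>One fibre of the Fuchsian metric: the principal triple under a Cartan involution with
  \<open>\<rho> Y0 = h X0\<close>\<close>

locale cartan_principal_lie_alg = principal_lie_alg br a X0 Y0 V m e + cartan_lie_alg br \<rho>
  for br :: "complex^'n \<Rightarrow> complex^'n \<Rightarrow> complex^'n" and a X0 Y0 V m e \<rho> +
  fixes h :: real
  assumes h: "h > 0" and rho_Y0: "\<rho> Y0 = of_real h *s X0"
begin

text \<open>The double sign gives the shape \<open>- x'\<close> expected by
  \<open>killing_form_adjoint\<close>: the adjoint of \<open>br X0\<close> is \<open>- 1 / h\<close>
  times \<open>br Y0\<close>.\<close>

lemma rho_X0: "\<rho> X0 = - (- of_real (1 / h) *s Y0)"
proof -
  have "\<rho> (of_real h *s X0) = Y0" using rho_rho[of Y0] by (simp add: rho_Y0)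
  then have "of_real h *s \<rho> X0 = Y0" by (simp add: rho_scale)
  then have "of_real (1 / h) *s (of_real h *s \<rho> X0) = of_real (1 / h) *s Y0" by simp
  then show ?thesis using h by (simp add: vector_smult_assoc vector_smult_lneg)
qed

lemma rho_a: "\<rho> a = - a"
proof -
  have "\<rho> (br X0 Y0) = br Y0 X0"
    using h by (simp add: rho_br rho_X0 rho_Y0 br_scale_left br_scale_right vector_smult_assoc
        vector_smult_lneg br_minus_left)
  then have "- \<rho> a = a" using br_commute[of Y0 X0] by (simp add: XY rho_minus)
  then show ?thesis by (metis minus_minus)
qed

text \<open>If \<open>Y0\<close> kills \<open>y\<close>, then
  \<open>[Y0, [X0, y]] = [a, y] = c y\<close>, and taking adjoints gives
  \<open>|[X0, y]|^2 = - (c / h) |y|^2\<close>. For \<open>c > 0\<close> this forces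
  \<open>y = 0\<close>.\<close>

lemma Y0_injective:
  assumes w: "br a y = of_real c *s y" and c: "c > 0" and Y: "br Y0 y = 0"
  shows "y = 0"
proof (rule eq_zero_if_killing_form_rho)
  have "br Y0 (br X0 y) = br a y"
    using br_commute[of Y0 X0] br_jacobi[of Y0 X0 y] by (simp add: XY Y)
  have "\<kappa> (br X0 y) (\<rho> (br X0 y)) = \<kappa> y (\<rho> (br (- of_real (1 / h) *s Y0) (br X0 y)))"
    by (rule killing_form_adjoint[OF rho_X0])
  also have "br (- of_real (1 / h) *s Y0) (br X0 y) = of_real (- c / h) *s y"
    using \<open>br Y0 (br X0 y) = br a y\<close> by (simp add: br_scale_left br_minus_left w vector_smult_assoc)
  also have "\<kappa> y (\<rho> (of_real (- c / h) *s y)) = of_real (- c / h) * \<kappa> y (\<rho> y)"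
    by (simp add: rho_scale killing_form_scale_right del: of_real_divide of_real_minus)
  finally have eq: "\<kappa> (br X0 y) (\<rho> (br X0 y)) = of_real (- c / h) * \<kappa> y (\<rho> y)" .
  have "Re (of_real r * z) = r * Re z" for r z by simp
  then have "Re (\<kappa> (br X0 y) (\<rho> (br X0 y))) = (- c / h) * Re (\<kappa> y (\<rho> y))" unfolding eq .
  moreover have "Re (\<kappa> (br X0 y) (\<rho> (br X0 y))) \<le> 0"
    using killing_form_rho_neg[of "br X0 y"] by (cases "br X0 y = 0") auto
  ultimately have "(c / h) * Re (\<kappa> y (\<rho> y)) \<ge> 0" by simp
  then show "Re (\<kappa> y (\<rho> y)) \<ge> 0" using c h by (simp add: zero_le_mult_iff zero_le_divide_iff)
qed

text \<open>Since \<open>\<rho> a = - a\<close>, the operator \<open>br a\<close> is self-adjoint,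
  and eigenvectors with distinct real eigenvalues are orthogonal.\<close>

lemma weight_orthogonal:
  assumes "br a x = of_real c *s x" "br a y = of_real d *s y" "c \<noteq> d"
  shows "\<kappa> x (\<rho> y) = 0"
  using killing_form_adjoint[OF rho_a, of x y] assms
  by (simp add: killing_form_scale_left killing_form_scale_right rho_scale)

text \<open>Each string meets weight \<open>0\<close> only at \<open>j = m k\<close>. Removing these
  components from \<open>v\<close> leaves a vector orthogonal to the zero weight space and contained
  in it, hence zero.\<close>

lemma weight_zero_span:
  assumes "br a v = 0"
  shows "v \<in> vec.span ((\<lambda>k. weight_vec k (m k)) ` {1..lie_rank br})" (is "_ \<in> vec.span ?S")
proof -
  have "\<exists>v0\<in>vec.span ?S. \<forall>y. br a y = 0 \<longrightarrow> \<kappa> (v - v0) (\<rho> y) = 0" for v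
    using span_weight_vec[of v]
  proof (induction rule: vec.span_induct_alt)
    case base
    then show ?case by (intro bexI[of _ 0]) (auto simp: vec.span_zero)
  next
    case (step c x y)
    then obtain k j where k: "k \<in> {1..lie_rank br}" and x: "x = weight_vec k j" by auto
    from step obtain y0 where y0: "y0 \<in> vec.span ?S" "\<And>z. br a z = 0 \<Longrightarrow> \<kappa> (y - y0) (\<rho> z) = 0" by blast
    define x0 where "x0 = (if j = m k then x else 0)"
    have "x0 \<in> vec.span ?S" using k by (auto simp: x0_def x vec.span_zero intro!: vec.span_base)
    moreover have "\<kappa> (x - x0) (\<rho> z) = 0" if "br a z = 0" for z
      using weight_orthogonal[of x "real (m k) - real j" z 0] that br_a_weight_vec[OF k, of j]
      by (auto simp: x0_def x)
    moreover have eq: "c *s x + y - (c *s x0 + y0) = c *s (x - x0) + (y - y0)"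
      by (simp add: vec_eq_iff algebra_simps)
    ultimately show ?case using y0 
      by (intro bexI[of _ "c *s x0 + y0"] allI impI, unfold eq killing_form_add_left killing_form_scale_left)
         (auto intro!: vec.span_add vec.span_scale)
  qed
  then obtain v0 where v0: "v0 \<in> vec.span ?S" "\<And>y. br a y = 0 \<Longrightarrow> \<kappa> (v - v0) (\<rho> y) = 0" by blast
  have "br a u = 0" if "u \<in> vec.span ?S" for u
    using that
  proof (induction rule: vec.span_induct_alt)
    case (step c x y)
    then show ?case using br_a_weight_vec by (auto simp: br_add_right br_scale_right)
  qed auto
  then have "br a (v - v0) = 0" using assms v0(1) by (simp add: br_diff_right)
  then have "v - v0 = 0" using v0(2) by (intro eq_zero_if_killing_form_rho) simp
  then show ?thesis using v0(1) by simp
qed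

text \<open>The element \<open>n = a + \<i> s\<close> acts as a normal operator for the hermitian form
  \<open>- \<kappa> x (\<rho> y)\<close>, so its generalized null space is the joint kernel of \<open>ad a\<close> and \<open>ad s\<close>.\<close>
lemma normal_null_space:
  assumes s: "\<rho> s = - s" and as: "br a s = 0" and v: "(br (a + \<i> *s s) ^^ k) v = 0"
  shows "br a v = 0 \<and> br s v = 0"
proof -
  define n where "n = a + \<i> *s s"
  \<comment> \<open>Up to the sign built into \<open>rn\<close>, this is the image of
    \<open>n\<close> under the involution: \<open>br n'\<close> is the adjoint of
    \<open>br n\<close>, and the two commute.\<close>
  define n' where "n' = a - \<i> *s s"
  have rn: "\<rho> n = - n'" and rn': "\<rho> n' = - n"
    using rho_add[of a "- (\<i> *s s)"]
    by (simp_all add: n_def n'_def rho_add rho_a rho_minus rho_scale s vector_smult_lneg)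
  have sa: "br s a = 0" using br_commute[of s a] as by simp
  have nn: "br n n' = 0"
    by (simp add: n_def n'_def br_add_left br_diff_right br_scale_left br_scale_right as sa)
  then have comm: "br n (br n' x) = br n' (br n x)" for x
    using br_jacobi[of n n' x] by (simp add: nn)
  have norm0: "br n' (br n x) = 0 \<Longrightarrow> br n x = 0" for x
    using killing_form_adjoint[OF rn, of x "br n x"] by (intro eq_zero_if_killing_form_rho) simp
  have norm0': "br n (br n' x) = 0 \<Longrightarrow> br n' x = 0" for x
    using killing_form_adjoint[OF rn', of x "br n' x"] by (intro eq_zero_if_killing_form_rho) simp
  \<comment> \<open>For a normal operator the kernel of the square is the kernel:
    \<open>n' n x\<close> has norm zero because \<open>n\<close> kills it.\<close>
  have sq: "br n x = 0" if "br n (br n x) = 0" for x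
  proof (rule norm0, rule eq_zero_if_killing_form_rho)
    let ?y = "br n' (br n x)"
    have "br n ?y = 0" using that by (simp add: comm)
    then show "Re (\<kappa> ?y (\<rho> ?y)) \<ge> 0" using killing_form_adjoint[OF rn', of "br n x" ?y] by simp
  qed
  have nv: "br n v = 0"
    using v unfolding n_def[symmetric]
  proof (induction k)
    case (Suc k)
    show ?case
    proof (cases k)
      case 0
      then show ?thesis using Suc.prems by simp
    next
      case (Suc k')
      then show ?thesis using Suc.prems Suc.IH sq by simp
    qed
  qed simp
  have n'v: "br n' v = 0" using norm0'[of v] nv by (simp add: comm)
  have "br n v + br n' v = 2 *s br a v" "br n v - br n' v = (2 * \<i>) *s br s v"
    by (simp_all add: n_def n'_def br_add_left br_diff_left br_scale_left vec_eq_iff)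
  then show ?thesis by (simp add: nv n'v vec_eq_iff)
qed

text \<open>Such an \<open>s\<close> commutes with the whole triple. The generalized null space of
  \<open>a + \<i> s\<close> has dimension at least the rank, yet lies in the zero weight space,
  which is spanned by at most that many vectors. So \<open>s\<close> kills every zero weight vector;
  climbing each string shows that it kills \<open>e k\<close>, and descending that it kills the
  whole algebra.\<close>

lemma centralizer_principal_trivial:
  assumes s: "\<rho> s = - s" and sY: "br s Y0 = 0"
  shows "s = 0"
proof -
  have "\<rho> (br s Y0) = - (of_real h *s br s X0)"
    by (simp add: rho_br s rho_Y0 br_minus_left br_scale_right)
  then have sX: "br s X0 = 0" using h sY by (simp add: vec_eq_iff)
  have "br s (br X0 Y0) = 0" by (simp add: br_jacobi[of s] sX sY)
  then have "br s a = 0" by (simp add: XY br_minus_right)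
  then have as: "br a s = 0" using br_commute[of a s] by simp
  let ?S = "(\<lambda>k. weight_vec k (m k)) ` {1..lie_rank br}"
  \<comment> \<open>Both \<open>br a\<close> and \<open>br s\<close> are self-adjoint; the factor
    \<open>\<i>\<close> makes them the hermitian and skew parts of one normal operator, so its
    kernel is their joint kernel.\<close>
  let ?n = "a + \<i> *s s"
  define Z where "Z = {v. br a v = 0 \<and> br s v = 0}"
  have subZ: "vec.subspace Z"
    by (auto simp: Z_def vec.subspace_def br_add_right br_scale_right)
  have "lie_rank br \<le> vec.dim {v. \<exists>k. (br ?n ^^ k) v = 0}"
    unfolding lie_rank_def by (rule Least_le) blast
  also have "\<dots> \<le> vec.dim Z"
    by (rule vec.dim_subset) (use normal_null_space[OF s as] in \<open>auto simp: Z_def\<close>)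
  finally have "lie_rank br \<le> vec.dim Z" .
  moreover have "vec.dim (vec.span ?S) \<le> lie_rank br"
    using vec.dim_le_card[of "vec.span ?S" ?S] card_image_le[of "{1..lie_rank br}" "\<lambda>k. weight_vec k (m k)"] by simp
  moreover have "Z \<subseteq> vec.span ?S" using weight_zero_span by (auto simp: Z_def)
  ultimately have Z: "Z = vec.span ?S"
    by (intro vec.subspace_dim_equal subZ vec.subspace_span) auto
  have sYc: "br Y0 (br s x) = br s (br Y0 x)" for x
    using br_jacobi[of s Y0 x] by (simp add: sY)
  have se: "br s (e k) = 0" if k: "k \<in> {1..lie_rank br}" for k
  proof -
    have "br s (weight_vec k (m k)) = 0" using Z vec.span_base[of _ ?S] k by (auto simp: Z_def)
    \<comment> \<open>Induction upwards from weight \<open>0\<close>: the vector at step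
      \<open>Suc d\<close> has positive weight \<open>Suc d\<close>, where \<open>Y0\<close> is
      injective.\<close>
    moreover have "br s (weight_vec k (m k - d)) = 0" if "d \<le> m k" for d
      using that
    proof (induction d)
      case (Suc d)
      let ?j = "m k - Suc d"
      have j: "m k - d = Suc ?j" using Suc.prems by simp
      show ?case
      proof (rule Y0_injective[of _ "real (m k) - real ?j"])
        show "br Y0 (br s (weight_vec k ?j)) = 0"
          using Suc j by (simp add: sYc weight_vec_Suc)
        show "br a (br s (weight_vec k ?j)) = of_real (real (m k) - real ?j) *s br s (weight_vec k ?j)"
          by (simp only: br_jacobi[of a s] as br_zero_left add_0 br_a_weight_vec[OF k] br_scale_right) simp
      qed (use Suc.prems in auto)
    qed (use calculation in simp)
    from this[of "m k"] show ?thesis by (simp add: weight_vec_0)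
  qed
  have sw: "br s (weight_vec k j) = 0" if "k \<in> {1..lie_rank br}" for k j
    by (induction j) (simp_all add: weight_vec_0 weight_vec_Suc se[OF that] sYc[symmetric])
  have "br s v = 0" for v
    using span_weight_vec[of v]
  proof (induction rule: vec.span_induct_alt)
    case (step c x y)
    then show ?case using sw by (auto simp: br_add_right br_scale_right)
  qed simp
  then show ?thesis by (rule center_trivial)
qed

end

section \<open>Directional and Wirtinger derivatives\<close>

text \<open>The direction precedes the point so that \<open>dir_deriv f v\<close> is again a
  function on the domain and can be differentiated further.\<close>

definition dir_deriv :: "('a::real_normed_vector \<Rightarrow> 'b::real_normed_vector) \<Rightarrow> 'a \<Rightarrow> 'a \<Rightarrow> 'b" where
  "dir_deriv f v p = frechet_derivative f (at p) v"

lemma dir_derivI: "(f has_derivative f') (at p) \<Longrightarrow> dir_deriv f v p = f' v"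
  unfolding dir_deriv_def by (rule frechet_derivative_eqI)

lemma dir_deriv_const [simp]: "dir_deriv (\<lambda>p. c) v p = 0"
  by (simp add: dir_deriv_def)

lemma smooth_on_dir_deriv: "smooth_on S f \<Longrightarrow> smooth_on S (dir_deriv f v)"
  using smooth_on_dd[of S f v] by (simp add: dir_deriv_def[abs_def])

lemma has_derivative_dir_deriv:
  "smooth_on S f \<Longrightarrow> p \<in> S \<Longrightarrow> (f has_derivative (\<lambda>v. dir_deriv f v p)) (at p)"
  using smooth_on_has_derivative by (simp add: dir_deriv_def)

lemma dir_deriv_commute:
  fixes f :: "'a::real_normed_vector \<Rightarrow> 'b::euclidean_space"
  shows "open S \<Longrightarrow> smooth_on S f \<Longrightarrow> p \<in> S \<Longrightarrow> dir_deriv (dir_deriv f u) v p = dir_deriv (dir_deriv f v) u p"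
  using smooth_on_dd_commute[of S f p u v] by (simp add: dir_deriv_def[abs_def])

lemma dir_deriv_cong:
  assumes "open S" "smooth_on S f" "p \<in> S" "\<And>q. q \<in> S \<Longrightarrow> f q = g q"
  shows "dir_deriv f v p = dir_deriv g v p"
  by (rule dir_derivI[symmetric, OF has_derivative_transform_within_open[OF has_derivative_dir_deriv[OF assms(2,3)] assms(1,3,4)]])

lemma dir_deriv_add:
  assumes "smooth_on S f" "smooth_on S g" "p \<in> S"
  shows "dir_deriv (\<lambda>q. f q + g q) v p = dir_deriv f v p + dir_deriv g v p"
  by (rule dir_derivI[OF has_derivative_add[OF assms(1,2)[THEN has_derivative_dir_deriv, OF assms(3)]]])

lemma dir_deriv_diff:
  assumes "smooth_on S f" "smooth_on S g" "p \<in> S"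
  shows "dir_deriv (\<lambda>q. f q - g q) v p = dir_deriv f v p - dir_deriv g v p"
  by (rule dir_derivI[OF has_derivative_diff[OF assms(1,2)[THEN has_derivative_dir_deriv, OF assms(3)]]])

lemma dir_deriv_sum:
  assumes "\<And>j. j \<in> I \<Longrightarrow> smooth_on S (f j)" "p \<in> S"
  shows "dir_deriv (\<lambda>q. \<Sum>j\<in>I. f j q) v p = (\<Sum>j\<in>I. dir_deriv (f j) v p)"
  by (rule dir_derivI[OF has_derivative_sum[OF assms(1)[THEN has_derivative_dir_deriv, OF _ assms(2)]]])

lemma dir_deriv_bounded_linear:
  assumes "bounded_linear L" "smooth_on S f" "p \<in> S"
  shows "dir_deriv (\<lambda>q. L (f q)) v p = L (dir_deriv f v p)"
  by (rule dir_derivI[OF bounded_linear.has_derivative[OF assms(1) has_derivative_dir_deriv[OF assms(2,3)]]])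

lemma dir_deriv_bilinear:
  assumes "bounded_bilinear B" "smooth_on S f" "smooth_on S g" "p \<in> S"
  shows "dir_deriv (\<lambda>q. B (f q) (g q)) v p = B (f p) (dir_deriv g v p) + B (dir_deriv f v p) (g p)"
  by (rule dir_derivI[OF bounded_bilinear.FDERIV[OF assms(1) assms(2,3)[THEN has_derivative_dir_deriv, OF assms(4)]]])

lemma dir_deriv_line:
  assumes "smooth_on S f" "p + t *\<^sub>R v \<in> S"
  shows "((\<lambda>t. f (p + t *\<^sub>R v)) has_vector_derivative dir_deriv f v (p + t *\<^sub>R v)) (at t)"
proof -
  have 1: "((\<lambda>t. p + t *\<^sub>R v) has_derivative (\<lambda>h. h *\<^sub>R v)) (at t)"
    by (auto intro!: derivative_eq_intros)
  note 2 = has_derivative_dir_deriv[OF assms]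
  show ?thesis unfolding has_vector_derivative_def
    using has_derivative_compose[OF 1 2] linear_scale[OF has_derivative_linear[OF 2]] by simp
qed

text \<open>A positive second derivative along the line makes the first one, which is zero at
  \<open>p\<close>, positive just beyond \<open>p\<close>; the function would then rise above its
  maximum.\<close>

lemma second_dir_deriv_le_zero_at_max:
  fixes u :: "'a::real_normed_vector \<Rightarrow> real"
  assumes S: "open S" and u: "smooth_on S u" and p: "p \<in> S" and max: "\<And>t. p + t *\<^sub>R v \<in> S \<Longrightarrow> u (p + t *\<^sub>R v) \<le> u p"
  shows "dir_deriv (dir_deriv u v) v p \<le> 0"
proof (rule ccontr)
  assume "\<not> ?thesis"
  then have pos: "dir_deriv (dir_deriv u v) v p > 0" by simp
  have "continuous_on UNIV (\<lambda>t::real. p + t *\<^sub>R v)" by (intro continuous_intros)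
  then have "open ((\<lambda>t. p + t *\<^sub>R v) -` S)" by (rule open_vimage[OF S])
  moreover have "0 \<in> (\<lambda>t. p + t *\<^sub>R v) -` S" using p by simp
  ultimately obtain d where "d > 0" "ball 0 d \<subseteq> (\<lambda>t. p + t *\<^sub>R v) -` S" by (rule openE)
  then have d: "d > 0" "\<And>t. \<bar>t\<bar> < d \<Longrightarrow> p + t *\<^sub>R v \<in> S" by (auto simp: subset_iff)
  define f where "f t = u (p + t *\<^sub>R v)" for t
  define f' where "f' t = dir_deriv u v (p + t *\<^sub>R v)" for t
  have f: "(f has_real_derivative f' t) (at t)" if "\<bar>t\<bar> < d" for t
    using dir_deriv_line[OF u d(2)[OF that]]
    by (simp add: f_def[abs_def] f'_def has_real_derivative_iff_has_vector_derivative)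
  have f': "(f' has_real_derivative dir_deriv (dir_deriv u v) v p) (at 0)"
    using dir_deriv_line[OF smooth_on_dir_deriv[OF u] d(2)[of 0]] d(1)
    by (simp add: f'_def[abs_def] has_real_derivative_iff_has_vector_derivative)
  have "f' 0 = 0"
    by (rule DERIV_local_max[OF f d(1)]) (use d max in \<open>auto simp: f_def\<close>)
  obtain r where r: "r > 0" "\<And>h. 0 < h \<Longrightarrow> h < r \<Longrightarrow> f' 0 < f' (0 + h)"
    using DERIV_pos_inc_right[OF f' pos] by blast
  define t where "t = min d r / 2"
  have t: "0 < t" "t < d" "t < r" using d r by (auto simp: t_def)
  have "f 0 < f t"
  proof (rule DERIV_pos_imp_increasing_open[OF t(1)])
    fix x assume "0 < x" "x < t"
    then show "\<exists>y. (f has_real_derivative y) (at x) \<and> 0 < y"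
      using f[of x] r(2)[of x] t \<open>f' 0 = 0\<close> by (intro exI[of _ "f' x"]) auto
  next
    show "continuous_on {0..t} f"
      using t by (intro continuous_at_imp_continuous_on ballI DERIV_isCont[OF f]) auto
  qed
  then show False using max[of t] d(2)[of t] t by (auto simp: f_def)
qed

text \<open>\<open>wirt (- \<i>)\<close> and \<open>wirt \<i>\<close> are \<open>\<partial>/\<partial>z\<close> and \<open>\<partial>/\<partial>zbar\<close> in the second variable.\<close>
definition wirt :: "complex \<Rightarrow> (real \<times> complex \<Rightarrow> complex^'n) \<Rightarrow> real \<times> complex \<Rightarrow> complex^'n" where
  "wirt c f p = (1/2) *s (dir_deriv f (0, 1) p + c *s dir_deriv f (0, \<i>) p)"

lemma bounded_linear_vector_smult: "bounded_linear (\<lambda>x :: complex^'n. c *s x)"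
proof -
  have "linear (\<lambda>x :: complex^'n. c *s x)"
    by (auto simp: linear_iff vec_eq_iff algebra_simps)
  then show ?thesis by (simp add: linear_conv_bounded_linear)
qed

lemma smooth_on_wirt: "open S \<Longrightarrow> smooth_on S f \<Longrightarrow> smooth_on S (wirt c f)"
  unfolding wirt_def[abs_def]
  by (intro smooth_on_bounded_linear[OF bounded_linear_vector_smult] smooth_on_add smooth_on_dir_deriv)

lemma wirt_cong:
  "open S \<Longrightarrow> smooth_on S f \<Longrightarrow> p \<in> S \<Longrightarrow> (\<And>q. q \<in> S \<Longrightarrow> f q = g q) \<Longrightarrow> wirt c f p = wirt c g p"
  unfolding wirt_def by (simp only: dir_deriv_cong[of S f p g])

lemma wirt_diff:
  "smooth_on S f \<Longrightarrow> smooth_on S g \<Longrightarrow> p \<in> S \<Longrightarrow> wirt c (\<lambda>q. f q - g q) p = wirt c f p - wirt c g p"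
  unfolding wirt_def by (simp add: dir_deriv_diff vec_eq_iff algebra_simps)

lemma wirt_const [simp]: "wirt c (\<lambda>q. v) p = 0"
  by (simp add: wirt_def)

text \<open>Symmetry of second derivatives; used with the time direction to differentiate the
  equations in the parameter.\<close>

lemma dir_deriv_wirt:
  assumes "open S" "smooth_on S f" "p \<in> S"
  shows "dir_deriv (wirt c f) v p = wirt c (dir_deriv f v) p"
proof -
  note sm = smooth_on_dir_deriv[OF assms(2)]
  note bl = bounded_linear_vector_smult
  have "dir_deriv (wirt c f) v p =
      (1/2) *s dir_deriv (\<lambda>q. dir_deriv f (0, 1) q + c *s dir_deriv f (0, \<i>) q) v p"
    unfolding wirt_def[abs_def]
    by (rule dir_deriv_bounded_linear[OF bl _ assms(3)])
       (intro smooth_on_add assms smooth_on_bounded_linear[OF bl] sm)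
  also have "\<dots> = (1/2) *s (dir_deriv (dir_deriv f (0, 1)) v p + dir_deriv (\<lambda>q. c *s dir_deriv f (0, \<i>) q) v p)"
    by (subst dir_deriv_add[where S = S]) (intro assms smooth_on_bounded_linear[OF bl] sm refl)+
  also have "dir_deriv (\<lambda>q. c *s dir_deriv f (0, \<i>) q) v p = c *s dir_deriv (dir_deriv f (0, \<i>)) v p"
    by (rule dir_deriv_bounded_linear[OF bl sm assms(3)])
  finally show ?thesis
    by (simp only: wirt_def[abs_def] dir_deriv_commute[OF assms, of "(0, 1)" v] dir_deriv_commute[OF assms, of "(0, \<i>)" v])
qed

lemma (in lie_alg) wirt_br:
  assumes "smooth_on S f" "smooth_on S g" "p \<in> S"
  shows "wirt c (\<lambda>q. br (f q) (g q)) p = br (wirt c f p) (g p) + br (f p) (wirt c g p)"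
  unfolding wirt_def dir_deriv_bilinear[OF bounded_bilinear_br assms]
  by (simp add: br_scale_left br_scale_right br_add_left br_add_right vec_eq_iff algebra_simps)

section \<open>First variation of the Chern connection\<close>

text \<open>A conjugate-linear \<open>R p\<close> is expanded as the sum of
  \<open>cnj (x $ j) *s R p (axis j 1)\<close>; this bilinearity gives product rules for
  \<open>R p (f p)\<close>.\<close>

lemma bounded_bilinear_cnj_component: "bounded_bilinear (\<lambda>(x :: complex^'n) (y :: complex^'m). cnj (x $ j) *s y)"
proof -
  have "bilinear (\<lambda>(x :: complex^'n) (y :: complex^'m). cnj (x $ j) *s y)"
    by (auto simp: bilinear_def linear_iff vec_eq_iff algebra_simps)
  then show ?thesis by (simp add: bilinear_conv_bounded_bilinear)
qed

text \<open>Points of \<open>S\<close> pair time with a local coordinate. The fixed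
  \<open>\<rho>0\<close> gives access to the facts on the Lie algebra itself; the varying
  involutions are \<open>R p\<close>.\<close>

locale chern_variation = cartan_lie_alg br \<rho>0
  for br :: "complex^'n \<Rightarrow> complex^'n \<Rightarrow> complex^'n" and \<rho>0 +
  fixes S :: "(real \<times> complex) set" and R :: "real \<times> complex \<Rightarrow> complex^'n \<Rightarrow> complex^'n"
    and A A' :: "real \<times> complex \<Rightarrow> complex^'n"
  assumes open_S: "open S"
    and cartan_R: "p \<in> S \<Longrightarrow> cartan_involution br (R p)"
    and smooth_R: "smooth_on S (\<lambda>p. R p v)"
    and smooth_A: "smooth_on S A"
    and chern_z: "p \<in> S \<Longrightarrow> wirt (- \<i>) (\<lambda>q. R q v) p + br (A' p) (R p v) = R p (br (A p) v)"
    and chern_zbar: "p \<in> S \<Longrightarrow> wirt \<i> (\<lambda>q. R q v) p + br (A p) (R p v) = R p (br (A' p) v)"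
begin

lemma cartan_lie_alg_R: "p \<in> S \<Longrightarrow> cartan_lie_alg br (R p)"
  using cartan_R by unfold_locales

lemmas R_add = cartan_lie_alg.rho_add[OF cartan_lie_alg_R]
  and R_scale = cartan_lie_alg.rho_scale[OF cartan_lie_alg_R]
  and R_R = cartan_lie_alg.rho_rho[OF cartan_lie_alg_R]
  and R_br = cartan_lie_alg.rho_br[OF cartan_lie_alg_R]
  and R_zero = cartan_lie_alg.rho_zero[OF cartan_lie_alg_R]

lemma R_expand:
  assumes p: "p \<in> S"
  shows "R p x = (\<Sum>j\<in>UNIV. cnj (x $ j) *s R p (axis j 1))"
proof -
  have s: "R p (\<Sum>j\<in>I. f j) = (\<Sum>j\<in>I. R p (f j))" for I :: "'n set" and f
    by (induction I rule: infinite_finite_induct) (auto simp: R_add[OF p] R_zero[OF p])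
  have "R p x = R p (\<Sum>j\<in>UNIV. x $ j *s axis j 1)" by (simp only: basis_expansion)
  then show ?thesis by (simp only: s R_scale[OF p])
qed

lemma smooth_R_comp:
  assumes f: "smooth_on S f"
  shows "smooth_on S (\<lambda>p. R p (f p))"
  by (rule smooth_on_cong[OF open_S R_expand[symmetric]], assumption)
     (intro smooth_on_sum open_S smooth_on_bilinear[OF bounded_bilinear_cnj_component] f smooth_R)

lemma smooth_br: "smooth_on S f \<Longrightarrow> smooth_on S g \<Longrightarrow> smooth_on S (\<lambda>p. br (f p) (g p))"
  by (rule smooth_on_bilinear[OF bounded_bilinear_br open_S])

lemma dir_deriv_br:
  assumes "smooth_on S f" "smooth_on S g" "p \<in> S"
  shows "dir_deriv (\<lambda>q. br (f q) (g q)) v p = br (f p) (dir_deriv g v p) + br (dir_deriv f v p) (g p)"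
  by (rule dir_deriv_bilinear[OF bounded_bilinear_br assms])

lemma dir_deriv_R_expand:
  assumes f: "smooth_on S f" and p: "p \<in> S"
  shows "dir_deriv (\<lambda>q. R q (f q)) v p =
    R p (dir_deriv f v p) + (\<Sum>j\<in>UNIV. cnj (f p $ j) *s dir_deriv (\<lambda>q. R q (axis j 1)) v p)"
proof -
  note bb = bounded_bilinear_cnj_component
  have sm: "smooth_on S (\<lambda>q. cnj (f q $ j) *s R q (axis j 1))" for j
    by (rule smooth_on_bilinear[OF bb open_S f smooth_R])
  have "dir_deriv (\<lambda>q. R q (f q)) v p = dir_deriv (\<lambda>q. \<Sum>j\<in>UNIV. cnj (f q $ j) *s R q (axis j 1)) v p"
    by (rule dir_deriv_cong[OF open_S smooth_R_comp[OF f] p R_expand])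
  also have "\<dots> = (\<Sum>j\<in>UNIV. dir_deriv (\<lambda>q. cnj (f q $ j) *s R q (axis j 1)) v p)"
    by (rule dir_deriv_sum[OF sm p])
  also have "\<dots> = (\<Sum>j\<in>UNIV. cnj (f p $ j) *s dir_deriv (\<lambda>q. R q (axis j 1)) v p +
      cnj (dir_deriv f v p $ j) *s R p (axis j 1))"
    by (intro sum.cong refl dir_deriv_bilinear[OF bb f smooth_R p])
  also have "\<dots> = (\<Sum>j\<in>UNIV. cnj (f p $ j) *s dir_deriv (\<lambda>q. R q (axis j 1)) v p) + R p (dir_deriv f v p)"
    unfolding sum.distrib R_expand[OF p, of "dir_deriv f v p"] ..
  finally show ?thesis by (simp add: add.commute)
qed

lemma dir_deriv_R_const:
  "p \<in> S \<Longrightarrow> dir_deriv (\<lambda>q. R q x) v p = (\<Sum>j\<in>UNIV. cnj (x $ j) *s dir_deriv (\<lambda>q. R q (axis j 1)) v p)"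
  using dir_deriv_R_expand[OF smooth_on_const[of S x]] by (simp add: R_zero)

lemma dir_deriv_R:
  assumes "smooth_on S f" "p \<in> S"
  shows "dir_deriv (\<lambda>q. R q (f q)) v p = R p (dir_deriv f v p) + dir_deriv (\<lambda>q. R q (f p)) v p"
  by (subst dir_deriv_R_const[OF assms(2), of "f p"]) (rule dir_deriv_R_expand[OF assms])

text \<open>Moving \<open>c\<close> through the conjugate-linear \<open>R p\<close> turns it into
  \<open>cnj c\<close>, so \<open>R\<close> interchanges the two Wirtinger derivatives.\<close>

lemma wirt_R:
  assumes "smooth_on S f" "p \<in> S"
  shows "wirt c (\<lambda>q. R q (f q)) p = R p (wirt (cnj c) f p) + wirt c (\<lambda>q. R q (f p)) p"
proof -
  have 1: "R p (wirt (cnj c) f p) = (1/2) *s (R p (dir_deriv f (0, 1) p) + c *s R p (dir_deriv f (0, \<i>) p))"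
    by (simp only: wirt_def R_add[OF assms(2)] R_scale[OF assms(2)] complex_cnj_cnj) simp
  have 2: "wirt c (\<lambda>q. R q (f q)) p =
      (1/2) *s ((R p (dir_deriv f (0, 1) p) + dir_deriv (\<lambda>q. R q (f p)) (0, 1) p)
        + c *s (R p (dir_deriv f (0, \<i>) p) + dir_deriv (\<lambda>q. R q (f p)) (0, \<i>) p))"
    unfolding wirt_def[of c "\<lambda>q. R q (f q)"] dir_deriv_R[OF assms, of "(0, 1)"]
      dir_deriv_R[OF assms, of "(0, \<i>)"] ..
  have 3: "(1/2) *s ((x + y) + c *s (z + w)) = (1/2) *s (x + c *s z) + (1/2) *s (y + c *s w)"
    for x y z w :: "complex^'n"
    by (simp only: vec.scale_right_distrib add.assoc add.left_commute add.commute)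
  show ?thesis unfolding 1 2 wirt_def[of c "\<lambda>q. R q (f p)"] by (rule 3)
qed

text \<open>The (1,0) part of the Chern connection on sections of the adjoint bundle.\<close>

definition nabla :: "(real \<times> complex \<Rightarrow> complex^'n) \<Rightarrow> real \<times> complex \<Rightarrow> complex^'n" where
  "nabla f p = wirt (- \<i>) f p + br (A' p) (f p)"

lemma wirt_z_R:
  assumes "smooth_on S f" "p \<in> S"
  shows "wirt (- \<i>) (\<lambda>q. R q (f q)) p = R p (wirt \<i> f p + br (A p) (f p)) - br (A' p) (R p (f p))"
proof -
  have "wirt (- \<i>) (\<lambda>q. R q (f p)) p = R p (br (A p) (f p)) - br (A' p) (R p (f p))"
    using chern_z[OF assms(2), of "f p"] by (simp only: eq_diff_eq)
  then show ?thesis by (simp add: wirt_R[OF assms] R_add[OF assms(2)])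
qed

lemma wirt_zbar_R:
  assumes "smooth_on S f" "p \<in> S"
  shows "wirt \<i> (\<lambda>q. R q (f q)) p = R p (nabla f p) - br (A p) (R p (f p))"
proof -
  have "wirt \<i> (\<lambda>q. R q (f p)) p = R p (br (A' p) (f p)) - br (A p) (R p (f p))"
    using chern_zbar[OF assms(2), of "f p"] by (simp only: eq_diff_eq)
  then show ?thesis by (simp add: wirt_R[OF assms] R_add[OF assms(2)] nabla_def)
qed

text \<open>The connection equations determine \<open>A'\<close> from \<open>R\<close> and
  \<open>A\<close>, so it inherits their joint smoothness in time and position.\<close>

lemma smooth_A': "smooth_on S A'"
proof -
  obtain L :: "'n \<Rightarrow> complex^'n \<Rightarrow> complex^'n" where L: "\<And>j. bounded_linear (L j)"
      "\<And>x. (\<Sum>j\<in>UNIV. L j (br x (axis j 1))) = x"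
    using ad_left_inverse by blast
  have eq: "R p (br (A p) (R p (axis j 1))) + R p (wirt \<i> (\<lambda>q. R q (axis j 1)) p) = br (A' p) (axis j 1)"
    if p: "p \<in> S" for p j
  proof -
    \<comment> \<open>Differentiating \<open>R \<circ> R = id\<close> isolates the bracket with
      \<open>A'\<close>.\<close>
    have "wirt (- \<i>) (\<lambda>q. R q (R q (axis j 1))) p = wirt (- \<i>) (\<lambda>q. axis j 1) p"
      by (rule wirt_cong[OF open_S smooth_R_comp[OF smooth_R] p]) (rule R_R)
    then have "0 = R p (wirt \<i> (\<lambda>q. R q (axis j 1)) p + br (A p) (R p (axis j 1))) - br (A' p) (R p (R p (axis j 1)))"
      unfolding wirt_z_R[OF smooth_R p] by simp
    then show ?thesis by (simp add: R_add[OF p] R_R[OF p] algebra_simps)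
  qed
  have "smooth_on S (\<lambda>p. \<Sum>j\<in>UNIV. L j (R p (br (A p) (R p (axis j 1))) + R p (wirt \<i> (\<lambda>q. R q (axis j 1)) p)))"
    by (intro smooth_on_sum open_S smooth_on_bounded_linear[OF L(1)] smooth_on_add smooth_R_comp
        smooth_br smooth_A smooth_on_wirt smooth_R)
  then show ?thesis
    by (rule smooth_on_cong[OF open_S, rotated]) (simp only: eq L(2))
qed

section \<open>The infinitesimal generator of the varying metrics\<close>

definition Rdot :: "real \<times> complex \<Rightarrow> complex^'n \<Rightarrow> complex^'n" where
  "Rdot p v = dir_deriv (\<lambda>q. R q v) (1, 0) p"

lemma Rdot_add: "p \<in> S \<Longrightarrow> Rdot p (x + y) = Rdot p x + Rdot p y"
  unfolding Rdot_def by (simp only: dir_deriv_R_const[where x = "x + y"] dir_deriv_R_const[where x = x]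
      dir_deriv_R_const[where x = y]) (simp add: sum.distrib vector_sadd_rdistrib)

lemma Rdot_scale: "p \<in> S \<Longrightarrow> Rdot p (c *s x) = cnj c *s Rdot p x"
  unfolding Rdot_def by (simp only: dir_deriv_R_const[where x = "c *s x"] dir_deriv_R_const[where x = x])
    (simp add: vec.scale_sum_right vector_smult_assoc)

lemma Rdot_br:
  assumes p: "p \<in> S"
  shows "Rdot p (br x y) = br (R p x) (Rdot p y) + br (Rdot p x) (R p y)"
proof -
  have "Rdot p (br x y) = dir_deriv (\<lambda>q. br (R q x) (R q y)) (1, 0) p"
    unfolding Rdot_def by (rule dir_deriv_cong[OF open_S smooth_R p R_br])
  then show ?thesis unfolding Rdot_def by (simp only: dir_deriv_br[OF smooth_R smooth_R p])
qed

text \<open>\<open>Rdot p \<circ> R p\<close> is complex linear, as a composite of two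
  conjugate-linear maps, and the time derivative of \<open>R_br\<close> makes it a
  derivation.\<close>

lemma Rdot_inner:
  assumes p: "p \<in> S"
  shows "\<exists>s. \<forall>v. Rdot p v = br s (R p v)"
proof -
  define D where "D x = Rdot p (R p x)" for x
  have "Vector_Spaces.linear (*s) (*s) D"
    by (auto simp: Vector_Spaces.linear_iff D_def R_add[OF p] R_scale[OF p] Rdot_add[OF p] Rdot_scale[OF p]
        vec.vector_space_axioms)
  moreover have "D (br x y) = br (D x) y + br x (D y)" for x y
    by (simp add: D_def R_br[OF p] Rdot_br[OF p] R_R[OF p] add.commute)
  ultimately obtain s where "\<forall>x. D x = br s x" using derivation_inner by blast
  then have "Rdot p v = br s (R p v)" for v unfolding D_def using R_R[OF p, of v] by metis
  then show ?thesis by blast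
qed

text \<open>The section \<open>s\<close> with time derivative of \<open>R\<close> equal to
  \<open>ad(s) \<circ> R\<close>. As the centre is trivial, no freedom is left in the
  choice.\<close>

definition sgen :: "real \<times> complex \<Rightarrow> complex^'n" where
  "sgen p = (SOME s. \<forall>v. Rdot p v = br s (R p v))"

lemma Rdot_eq:
  assumes p: "p \<in> S"
  shows "Rdot p v = br (sgen p) (R p v)"
proof -
  have "\<forall>v. Rdot p v = br (sgen p) (R p v)"
    unfolding sgen_def by (rule someI_ex[OF Rdot_inner[OF p]])
  then show ?thesis ..
qed

lemma dir_deriv_R_time:
  assumes "smooth_on S f" "p \<in> S"
  shows "dir_deriv (\<lambda>q. R q (f q)) (1, 0) p = R p (dir_deriv f (1, 0) p) + br (sgen p) (R p (f p))"
  unfolding dir_deriv_R[OF assms] Rdot_eq[OF assms(2), symmetric] Rdot_def ..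

lemma R_br_sgen: "p \<in> S \<Longrightarrow> R p (br (sgen p) (R p v)) + br (sgen p) v = 0"
proof -
  assume p: "p \<in> S"
  have "dir_deriv (\<lambda>q. R q (R q v)) (1, 0) p = dir_deriv (\<lambda>q. v) (1, 0) p"
    by (rule dir_deriv_cong[OF open_S smooth_R_comp[OF smooth_R] p]) (rule R_R)
  then show ?thesis
    unfolding dir_deriv_R_time[OF smooth_R p] Rdot_def[symmetric] Rdot_eq[OF p] R_R[OF p] by simp
qed

text \<open>The time derivative of \<open>R \<circ> R = id\<close> gives this after bracketing with
  any vector, and the centre is trivial.\<close>

lemma R_sgen:
  assumes p: "p \<in> S"
  shows "R p (sgen p) = - sgen p"
proof (rule br_left_eqD)
  fix z show "br (R p (sgen p)) z = br (- sgen p) z"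
    using R_br_sgen[OF p, of z]
    unfolding R_br[OF p] R_R[OF p] br_minus_left eq_neg_iff_add_eq_0 .
qed

lemma smooth_sgen: "smooth_on S sgen"
proof -
  obtain L :: "'n \<Rightarrow> complex^'n \<Rightarrow> complex^'n" where L: "\<And>j. bounded_linear (L j)"
      "\<And>x. (\<Sum>j\<in>UNIV. L j (br x (axis j 1))) = x"
    using ad_left_inverse by blast
  have eq: "- R p (dir_deriv (\<lambda>q. R q (axis j 1)) (1, 0) p) = br (sgen p) (axis j 1)"
    if p: "p \<in> S" for p j
    using R_br_sgen[OF p, of "axis j 1"]
    unfolding Rdot_eq[OF p, symmetric] Rdot_def by (rule minus_unique)
  have "smooth_on S (\<lambda>p. \<Sum>j\<in>UNIV. L j (- R p (dir_deriv (\<lambda>q. R q (axis j 1)) (1, 0) p)))"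
    by (intro smooth_on_sum open_S smooth_on_bounded_linear[OF L(1)]
        smooth_on_bounded_linear[OF bounded_linear_minus[OF bounded_linear_ident]] smooth_R_comp
        smooth_on_dir_deriv smooth_R)
  then show ?thesis
    by (rule smooth_on_cong[OF open_S, rotated]) (simp only: eq L(2))
qed

text \<open>The time derivative of the equation \<open>chern_z\<close>.\<close>
lemma dir_deriv_A'_time:
  assumes p: "p \<in> S"
  shows "dir_deriv A' (1, 0) p = R p (dir_deriv A (1, 0) p) - nabla sgen p"
proof -
  let ?d = "\<lambda>f. dir_deriv f (1, 0) p"
  \<comment> \<open>The two elements are compared through their brackets with \<open>R p v\<close>,
    which runs through the whole algebra since \<open>R p\<close> is an involution.\<close>
  have *: "br (nabla sgen p + ?d A') (R p v) = br (R p (?d A)) (R p v)" for v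
  proof -
    have "?d (\<lambda>q. wirt (- \<i>) (\<lambda>q. R q v) q + br (A' q) (R q v)) = ?d (\<lambda>q. R q (br (A q) v))"
      by (rule dir_deriv_cong[OF open_S _ p chern_z])
         (intro smooth_on_add open_S smooth_on_wirt smooth_R smooth_br smooth_A')
    also have "\<dots> = R p (?d (\<lambda>q. br (A q) v)) + br (sgen p) (R p (br (A p) v))"
      by (rule dir_deriv_R_time[OF smooth_br[OF smooth_A smooth_on_const] p])
    also have "?d (\<lambda>q. br (A q) v) = br (?d A) v"
      by (simp add: dir_deriv_br[OF smooth_A smooth_on_const p])
    also have "?d (\<lambda>q. wirt (- \<i>) (\<lambda>q. R q v) q + br (A' q) (R q v)) =
        ?d (wirt (- \<i>) (\<lambda>q. R q v)) + ?d (\<lambda>q. br (A' q) (R q v))"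
      by (rule dir_deriv_add[OF smooth_on_wirt[OF open_S smooth_R] smooth_br[OF smooth_A' smooth_R] p])
    also have "?d (wirt (- \<i>) (\<lambda>q. R q v)) = wirt (- \<i>) (dir_deriv (\<lambda>q. R q v) (1, 0)) p"
      by (rule dir_deriv_wirt[OF open_S smooth_R p])
    also have "\<dots> = wirt (- \<i>) (\<lambda>q. br (sgen q) (R q v)) p"
      by (rule wirt_cong[OF open_S smooth_on_dir_deriv[OF smooth_R] p])
         (simp add: Rdot_eq[symmetric] Rdot_def)
    also have "\<dots> = br (wirt (- \<i>) sgen p) (R p v) + br (sgen p) (wirt (- \<i>) (\<lambda>q. R q v) p)"
      by (rule wirt_br[OF smooth_sgen smooth_R p])
    also have "wirt (- \<i>) (\<lambda>q. R q v) p = R p (br (A p) v) - br (A' p) (R p v)"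
      using chern_z[OF p, of v] by (simp add: eq_diff_eq)
    also have "?d (\<lambda>q. br (A' q) (R q v)) = br (A' p) (br (sgen p) (R p v)) + br (?d A') (R p v)"
      unfolding dir_deriv_br[OF smooth_A' smooth_R p] using Rdot_eq[OF p, of v] by (simp add: Rdot_def)
    finally show ?thesis
      by (simp add: nabla_def br_add_left br_diff_right R_br[OF p] br_jacobi[of "A' p" "sgen p"] algebra_simps)
  qed
  have "nabla sgen p + ?d A' = R p (?d A)"
  proof (rule br_left_eqD)
    fix z show "br (nabla sgen p + ?d A') z = br (R p (?d A)) z" using *[of "R p z"] by (simp add: R_R[OF p])
  qed
  then show ?thesis by (simp add: eq_diff_eq add.commute)
qed

lemma smooth_nabla: "smooth_on S f \<Longrightarrow> smooth_on S (nabla f)"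
  unfolding nabla_def[abs_def] by (intro smooth_on_add open_S smooth_on_wirt smooth_br smooth_A')

text \<open>By \<open>R_sgen\<close> this is \<open>- \<kappa> s (R p s)\<close>, the squared norm
  of \<open>s\<close>; written without \<open>R\<close>, its derivatives involve those of
  \<open>s\<close> alone.\<close>

definition energy :: "real \<times> complex \<Rightarrow> complex" where
  "energy q = \<kappa> (sgen q) (sgen q)"

lemma smooth_kappa: "smooth_on S f \<Longrightarrow> smooth_on S g \<Longrightarrow> smooth_on S (\<lambda>q. \<kappa> (f q) (g q))"
  by (rule smooth_on_bilinear[OF bounded_bilinear_killing_form open_S])

lemma smooth_energy: "smooth_on S energy"
  unfolding energy_def[abs_def] by (rule smooth_kappa[OF smooth_sgen smooth_sgen])

end

section \<open>The Laplacian of the squared norm of the variation\<close>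

text \<open>\<open>hitchin\<close> is an identity on all of \<open>S\<close> because it gets
  differentiated in time. At the point \<open>p\<close>, \<open>adot_holo\<close> expresses that
  \<open>b\<close> is antiholomorphic, \<open>phidot\<close> that the \<open>e k\<close> are highest
  weight vectors.\<close>

locale higgs_variation = chern_variation br \<rho>0 S R A A'
  for br :: "complex^'n \<Rightarrow> complex^'n \<Rightarrow> complex^'n" and \<rho>0 S R A A' +
  fixes \<Phi> :: "real \<times> complex \<Rightarrow> complex^'n" and p :: "real \<times> complex"
  assumes smooth_Phi: "smooth_on S \<Phi>"
    and hitchin: "q \<in> S \<Longrightarrow> wirt (- \<i>) A q - wirt \<i> A' q + br (A' q) (A q) = br (\<Phi> q) (R q (\<Phi> q))"
    and p: "p \<in> S" and A_p: "A p = 0"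
    and adot_holo: "wirt \<i> (\<lambda>q. R q (dir_deriv A (1, 0) q)) p = 0"
    and phidot: "br (dir_deriv \<Phi> (1, 0) p) (R p (\<Phi> p)) = 0"
begin

text \<open>The time derivative of Hitchin's equation: on the left the terms in the derivative of
  \<open>A\<close> combine to its \<open>nabla\<close>, which vanishes, and
  \<open>dir_deriv_A'_time\<close> replaces the derivative of \<open>A'\<close>; on the right both
  terms in the derivative of \<open>\<Phi>\<close> vanish.\<close>

lemma wirt_zbar_nabla_sgen: "wirt \<i> (nabla sgen) p = br (\<Phi> p) (br (sgen p) (R p (\<Phi> p)))"
proof -
  let ?d = "\<lambda>f. dir_deriv f (1, 0) p"
  let ?Ad = "dir_deriv A (1, 0)"
  have smAd: "smooth_on S ?Ad" by (rule smooth_on_dir_deriv[OF smooth_A])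
  \<comment> \<open>\<open>R\<close> carries the (1,0) derivative of \<open>?Ad\<close> to the (0,1)
    derivative of its conjugate, which is zero by \<open>adot_holo\<close>.\<close>
  have 0: "R p (nabla ?Ad p) = 0"
    using adot_holo wirt_zbar_R[OF smAd p] by (simp add: A_p)
  have "R p (R p (nabla ?Ad p)) = nabla ?Ad p" by (rule R_R[OF p])
  then have nabla0: "nabla ?Ad p = 0" unfolding 0 R_zero[OF p] by simp
  have "wirt \<i> (dir_deriv A' (1, 0)) p = wirt \<i> (\<lambda>q. R q (?Ad q) - nabla sgen q) p"
    by (rule wirt_cong[OF open_S smooth_on_dir_deriv[OF smooth_A'] p dir_deriv_A'_time])
  also have "\<dots> = wirt \<i> (\<lambda>q. R q (?Ad q)) p - wirt \<i> (nabla sgen) p"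
    by (rule wirt_diff[OF smooth_R_comp[OF smAd] smooth_nabla[OF smooth_sgen] p])
  finally have A'd: "wirt \<i> (dir_deriv A' (1, 0)) p = - wirt \<i> (nabla sgen) p"
    by (simp add: adot_holo)
  note sm = smooth_on_diff[OF open_S smooth_on_wirt[OF open_S smooth_A] smooth_on_wirt[OF open_S smooth_A']]
  have "?d (\<lambda>q. wirt (- \<i>) A q - wirt \<i> A' q + br (A' q) (A q)) = ?d (\<lambda>q. br (\<Phi> q) (R q (\<Phi> q)))"
    by (rule dir_deriv_cong[OF open_S smooth_on_add[OF open_S sm smooth_br[OF smooth_A' smooth_A]] p hitchin])
  also have "\<dots> = br (\<Phi> p) (?d (\<lambda>q. R q (\<Phi> q))) + br (?d \<Phi>) (R p (\<Phi> p))"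
    by (rule dir_deriv_br[OF smooth_Phi smooth_R_comp[OF smooth_Phi] p])
  also have "?d (\<lambda>q. R q (\<Phi> q)) = R p (?d \<Phi>) + br (sgen p) (R p (\<Phi> p))"
    by (rule dir_deriv_R_time[OF smooth_Phi p])
  also have "?d (\<lambda>q. wirt (- \<i>) A q - wirt \<i> A' q + br (A' q) (A q)) =
      ?d (\<lambda>q. wirt (- \<i>) A q - wirt \<i> A' q) + ?d (\<lambda>q. br (A' q) (A q))"
    by (rule dir_deriv_add[OF sm smooth_br[OF smooth_A' smooth_A] p])
  also have "?d (\<lambda>q. wirt (- \<i>) A q - wirt \<i> A' q) = ?d (wirt (- \<i>) A) - ?d (wirt \<i> A')"
    by (rule dir_deriv_diff[OF smooth_on_wirt[OF open_S smooth_A] smooth_on_wirt[OF open_S smooth_A'] p])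
  also have "?d (wirt (- \<i>) A) = wirt (- \<i>) ?Ad p" by (rule dir_deriv_wirt[OF open_S smooth_A p])
  also have "?d (wirt \<i> A') = - wirt \<i> (nabla sgen) p"
    unfolding dir_deriv_wirt[OF open_S smooth_A' p] A'd ..
  also have "?d (\<lambda>q. br (A' q) (A q)) = br (A' p) (?Ad p)"
    unfolding dir_deriv_br[OF smooth_A' smooth_A p] A_p by simp
  finally have "nabla ?Ad p + wirt \<i> (nabla sgen) p = br (\<Phi> p) (R p (?d \<Phi>) + br (sgen p) (R p (\<Phi> p)))"
    by (simp add: nabla_def[of ?Ad p] phidot add_ac)
  moreover have "br (\<Phi> p) (R p (?d \<Phi>)) = 0"
  proof -
    have "br (R p (\<Phi> p)) (?d \<Phi>) = 0" using phidot br_commute[of "R p (\<Phi> p)" "?d \<Phi>"] by simp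
    then have "R p (br (R p (\<Phi> p)) (?d \<Phi>)) = 0" by (simp add: R_zero[OF p])
    then show ?thesis unfolding R_br[OF p] R_R[OF p] .
  qed
  ultimately show ?thesis by (simp add: nabla0 br_add_right)
qed

lemma kappa_wirt: "\<kappa> (wirt c f q) x = (1/2) * (\<kappa> (dir_deriv f (0, 1) q) x + c * \<kappa> (dir_deriv f (0, \<i>) q) x)"
  unfolding wirt_def killing_form_scale_left killing_form_add_left ..

text \<open>The Laplacian is four times d/dzbar d/dz, and \<open>F\<close> is half of d/dz of the
  energy; d/dzbar of \<open>F\<close> follows from the product rule.\<close>

lemma laplacian_energy:
  "dir_deriv (dir_deriv energy (0, 1)) (0, 1) p + dir_deriv (dir_deriv energy (0, \<i>)) (0, \<i>) p =
    8 * (\<kappa> (wirt \<i> (nabla sgen) p) (sgen p) + \<kappa> (wirt \<i> sgen p) (nabla sgen p))"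
proof -
  define F where "F q = \<kappa> (nabla sgen q) (sgen q)" for q
  let ?u1 = "dir_deriv energy (0, 1)" and ?u2 = "dir_deriv energy (0, \<i>)"
  have Du: "dir_deriv energy v q = 2 * \<kappa> (dir_deriv sgen v q) (sgen q)" if "q \<in> S" for v q
    unfolding energy_def[abs_def] dir_deriv_bilinear[OF bounded_bilinear_killing_form smooth_sgen smooth_sgen that]
    by (simp add: killing_form_commute)
  \<comment> \<open>The connection term \<open>\<kappa> [A', s] s\<close> vanishes by invariance, so
    \<open>nabla\<close> may replace the plain derivative.\<close>
  have F: "F q = (1/4) * (?u1 q - \<i> * ?u2 q)" if "q \<in> S" for q
    unfolding F_def nabla_def killing_form_add_left kappa_wirt Du[OF that]
    by (simp add: killing_form_invariant algebra_simps)
  note sm = smooth_on_dir_deriv[OF smooth_energy]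
  note bl = bounded_linear_mult_right
  have smF: "smooth_on S F" unfolding F_def[abs_def] by (rule smooth_kappa[OF smooth_nabla[OF smooth_sgen] smooth_sgen])
  have smi: "smooth_on S (\<lambda>q. \<i> * ?u2 q)" by (rule smooth_on_bounded_linear[OF bl open_S sm])
  have DF1: "dir_deriv F v p = (1/4) * (dir_deriv ?u1 v p - \<i> * dir_deriv ?u2 v p)" for v
  proof -
    have "dir_deriv F v p = dir_deriv (\<lambda>q. (1/4) * (?u1 q - \<i> * ?u2 q)) v p"
      by (rule dir_deriv_cong[OF open_S smF p F])
    also have "\<dots> = (1/4) * dir_deriv (\<lambda>q. ?u1 q - \<i> * ?u2 q) v p"
      by (rule dir_deriv_bounded_linear[OF bl smooth_on_diff[OF open_S sm smi] p])
    also have "dir_deriv (\<lambda>q. ?u1 q - \<i> * ?u2 q) v p = dir_deriv ?u1 v p - dir_deriv (\<lambda>q. \<i> * ?u2 q) v p"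
      by (rule dir_deriv_diff[OF sm smi p])
    also have "dir_deriv (\<lambda>q. \<i> * ?u2 q) v p = \<i> * dir_deriv ?u2 v p"
      by (rule dir_deriv_bounded_linear[OF bl sm p])
    finally show ?thesis .
  qed
  have DF2: "dir_deriv F v p = \<kappa> (dir_deriv sgen v p) (nabla sgen p) + \<kappa> (dir_deriv (nabla sgen) v p) (sgen p)" for v
    unfolding F_def[abs_def]
      dir_deriv_bilinear[OF bounded_bilinear_killing_form smooth_nabla[OF smooth_sgen] smooth_sgen p]
    by (simp add: killing_form_commute)
  have comm: "dir_deriv ?u2 (0, 1) p = dir_deriv ?u1 (0, \<i>) p"
    by (rule dir_deriv_commute[OF open_S smooth_energy p])
  have "dir_deriv ?u1 (0, 1) p + dir_deriv ?u2 (0, \<i>) p = 4 * (dir_deriv F (0, 1) p + \<i> * dir_deriv F (0, \<i>) p)"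
    unfolding DF1 comm by (simp add: algebra_simps)
  also have "\<dots> = 8 * (\<kappa> (wirt \<i> (nabla sgen) p) (sgen p) + \<kappa> (wirt \<i> sgen p) (nabla sgen p))"
    unfolding DF2 kappa_wirt by (simp add: algebra_simps)
  finally show ?thesis .
qed

text \<open>Differentiate \<open>R s = - s\<close>; since \<open>A p = 0\<close>, the (0,1)
  derivative at \<open>p\<close> has no connection term.\<close>

lemma wirt_zbar_sgen: "wirt \<i> sgen p = - R p (nabla sgen p)"
proof -
  have "wirt \<i> (\<lambda>q. R q (sgen q)) p = wirt \<i> (\<lambda>q. 0 - sgen q) p"
    by (rule wirt_cong[OF open_S smooth_R_comp[OF smooth_sgen] p]) (simp add: R_sgen)
  also have "\<dots> = 0 - wirt \<i> sgen p"
    using wirt_diff[OF smooth_on_const[of S 0] smooth_sgen p] by simp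
  finally show ?thesis using wirt_zbar_R[OF smooth_sgen p] by (simp add: A_p eq_neg_iff_add_eq_0 neg_eq_iff_add_eq_0 add.commute)
qed

text \<open>The two summands of the Laplacian are the squared norms of \<open>[s, \<Phi>]\<close> and \<open>\<nabla>\<^sup>1\<^sup>,\<^sup>0 s\<close>.\<close>
lemma commute_if_laplacian_energy_nonpos:
  assumes "Re (dir_deriv (dir_deriv energy (0, 1)) (0, 1) p + dir_deriv (dir_deriv energy (0, \<i>)) (0, \<i>) p) \<le> 0"
  shows "br (sgen p) (\<Phi> p) = 0"
proof -
  interpret Rp: cartan_lie_alg br "R p" by (rule cartan_lie_alg_R[OF p])
  have neg: "Re (\<kappa> x (R p x)) \<le> 0" for x
    using Rp.killing_form_rho_neg[of x] by (cases "x = 0") auto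
  let ?t = "br (sgen p) (\<Phi> p)"
  have "R p ?t = - br (sgen p) (R p (\<Phi> p))" by (simp add: R_br[OF p] R_sgen[OF p] br_minus_left)
  \<comment> \<open>Written through \<open>?t\<close>, the curvature term becomes
    \<open>- \<kappa> ?t (R p ?t)\<close> by invariance of the form.\<close>
  then have z: "br (sgen p) (R p (\<Phi> p)) = - R p ?t" by simp
  have "\<kappa> (br (\<Phi> p) (- R p ?t)) (sgen p) = \<kappa> (br (R p ?t) (\<Phi> p)) (sgen p)"
    using br_commute[of "\<Phi> p" "R p ?t"] by (simp add: br_minus_right)
  also have "\<dots> = \<kappa> (R p ?t) (br (\<Phi> p) (sgen p))" by (rule killing_form_invariant)
  also have "\<dots> = - \<kappa> ?t (R p ?t)"
    unfolding br_commute[of "\<Phi> p" "sgen p"] killing_form_minus_right by (simp add: killing_form_commute)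
  finally have 1: "\<kappa> (wirt \<i> (nabla sgen) p) (sgen p) = - \<kappa> ?t (R p ?t)"
    unfolding wirt_zbar_nabla_sgen z .
  have 2: "\<kappa> (wirt \<i> sgen p) (nabla sgen p) = - \<kappa> (nabla sgen p) (R p (nabla sgen p))"
    unfolding wirt_zbar_sgen killing_form_minus_left by (simp add: killing_form_commute)
  have "Re (8 * (- \<kappa> ?t (R p ?t) + - \<kappa> (nabla sgen p) (R p (nabla sgen p)))) \<le> 0"
    using assms unfolding laplacian_energy 1 2 .
  then have "Re (\<kappa> ?t (R p ?t)) \<ge> 0" using neg[of "nabla sgen p"] by simp
  then show ?thesis by (rule Rp.eq_zero_if_killing_form_rho)
qed

lemma commute_at_energy_max:
  assumes max: "\<And>w. (fst p, w) \<in> S \<Longrightarrow> Re (energy (fst p, w)) \<le> Re (energy p)"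
  shows "br (sgen p) (\<Phi> p) = 0"
proof (rule commute_if_laplacian_energy_nonpos)
  have smR: "smooth_on S (\<lambda>q. Re (energy q))"
    by (rule smooth_on_bounded_linear[OF bounded_linear_Re open_S smooth_energy])
  have "Re (dir_deriv (dir_deriv energy (0, c)) (0, c) p) \<le> 0" for c
  proof -
    have "dir_deriv (\<lambda>q. Re (energy q)) (0, c) q = Re (dir_deriv energy (0, c) q)" if "q \<in> S" for q
      by (rule dir_deriv_bounded_linear[OF bounded_linear_Re smooth_energy that])
    then have "dir_deriv (dir_deriv (\<lambda>q. Re (energy q)) (0, c)) (0, c) p =
        dir_deriv (\<lambda>q. Re (dir_deriv energy (0, c) q)) (0, c) p"
      by (rule dir_deriv_cong[OF open_S smooth_on_dir_deriv[OF smR] p])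
    also have "\<dots> = Re (dir_deriv (dir_deriv energy (0, c)) (0, c) p)"
      by (rule dir_deriv_bounded_linear[OF bounded_linear_Re smooth_on_dir_deriv[OF smooth_energy] p])
    finally have "Re (dir_deriv (dir_deriv energy (0, c)) (0, c) p) =
        dir_deriv (dir_deriv (\<lambda>q. Re (energy q)) (0, c)) (0, c) p" by simp
    also have "\<dots> \<le> 0"
    proof (rule second_dir_deriv_le_zero_at_max[OF open_S smR p])
      fix t assume "p + t *\<^sub>R (0, c) \<in> S"
      moreover have "p + t *\<^sub>R (0, c) = (fst p, snd p + t *\<^sub>R c)" by (simp add: prod_eq_iff)
      ultimately show "Re (energy (p + t *\<^sub>R (0, c))) \<le> Re (energy p)" using max by simp
    qed
    finally show ?thesis .
  qed
  then show "Re (dir_deriv (dir_deriv energy (0, 1)) (0, 1) p + dir_deriv (dir_deriv energy (0, \<i>)) (0, \<i>) p) \<le> 0"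
    by (simp add: add_nonpos_nonpos)
qed

end

text \<open>\<open>T\<close> conjugates \<open>br s\<close> to \<open>br s'\<close>, and the trace
  of the square survives conjugation. It makes the squared norm of \<open>s\<close> independent of
  the chart.\<close>

lemma (in lie_alg) killing_form_intertwine:
  assumes T: "Vector_Spaces.linear (*s) (*s) T" "surj T" and int: "\<And>x. br s' (T x) = T (br s x)"
  shows "\<kappa> s' s' = \<kappa> s s"
proof -
  let ?M = "matrix T"
  obtain g where g: "Vector_Spaces.linear (*s) (*s) g" "T \<circ> g = id"
    using vec.linear_surj_right_inverse[OF T(1), of UNIV UNIV] T(2) by (auto simp: fun_eq_iff)
  let ?N = "matrix g"
  have id1: "matrix (id :: complex^'n \<Rightarrow> complex^'n) = mat 1"
    by (auto simp: matrix_def mat_def axis_def vec_eq_iff)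
  have MN: "?M ** ?N = mat 1"
    using matrix_compose_gen[OF g(1) T(1)] by (simp only: g(2) id1)
  then have NM: "?N ** ?M = mat 1" by (simp add: matrix_left_right_inverse)
  have "br s' \<circ> T = T \<circ> br s" using int by (simp add: fun_eq_iff)
  then have "ad s' ** ?M = ?M ** ad s"
    using matrix_compose_gen[OF T(1) linear_br[of s']] matrix_compose_gen[OF linear_br[of s] T(1)] by simp
  then have "ad s' ** ?M ** ?N = ?M ** ad s ** ?N" by simp
  then have s': "ad s' = ?M ** ad s ** ?N" by (simp add: matrix_mul_assoc[symmetric] MN)
  have "\<kappa> s' s' = trace (?M ** (ad s ** (?N ** ?M) ** ad s ** ?N))"
    by (simp add: killing_form_eq_trace s' matrix_mul_assoc)
  also have "\<dots> = trace (ad s ** ad s ** (?N ** ?M))"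
    by (subst trace_mul_sym) (simp add: NM matrix_mul_assoc[symmetric])
  finally show ?thesis by (simp add: NM killing_form_eq_trace)
qed

section \<open>Fixed times, fixed points, and a maximum over all charts\<close>

lemma slice_has_derivative:
  assumes "smooth_on S f" "(\<epsilon>, w) \<in> S"
  shows "((\<lambda>w'. f (\<epsilon>, w')) has_derivative (\<lambda>v. dir_deriv f (0, v) (\<epsilon>, w))) (at w)"
proof -
  have "((\<lambda>w'. (\<epsilon>, w')) has_derivative (\<lambda>v. (0, v))) (at w)"
    by (intro has_derivative_Pair has_derivative_const has_derivative_ident)
  from has_derivative_compose[OF this has_derivative_dir_deriv[OF assms]] show ?thesis .
qed

lemma wirt_z_slice:
  "smooth_on S f \<Longrightarrow> (\<epsilon>, w) \<in> S \<Longrightarrow> wirt_z (\<lambda>w'. f (\<epsilon>, w')) w = wirt (- \<i>) f (\<epsilon>, w)"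
  unfolding wirt_z_def wirt_def by (simp add: frechet_derivative_eqI[OF slice_has_derivative] vector_smult_lneg)

lemma wirt_zbar_slice:
  "smooth_on S f \<Longrightarrow> (\<epsilon>, w) \<in> S \<Longrightarrow> wirt_zbar (\<lambda>w'. f (\<epsilon>, w')) w = wirt \<i> f (\<epsilon>, w)"
  unfolding wirt_zbar_def wirt_def by (simp add: frechet_derivative_eqI[OF slice_has_derivative])

text \<open>The Cauchy-Riemann equations for the coefficients, the vectors \<open>e k\<close> being
  constant.\<close>

lemma wirt_zbar_phi_form:
  assumes U: "open U" "w \<in> U" and f: "\<And>k. k \<in> {1..l} \<Longrightarrow> f k i holomorphic_on U"
  shows "wirt_zbar (phi_form l e f i) w = 0"
proof -
  have "((\<lambda>w. f k i w *s e k) has_derivative (\<lambda>v. (deriv (f k i) w * v) *s e k)) (at w)"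
    if k: "k \<in> {1..l}" for k
  proof -
    have "linear (\<lambda>c :: complex. c *s e k)"
      by (auto simp: linear_iff vec_eq_iff algebra_simps)
    then have "bounded_linear (\<lambda>c :: complex. c *s e k)" by (simp add: linear_conv_bounded_linear)
    moreover have "(f k i has_derivative (\<lambda>v. deriv (f k i) w * v)) (at w)"
      using holomorphic_derivI[OF f[OF k] U] by (simp add: has_field_derivative_def)
    ultimately show ?thesis by (rule bounded_linear.has_derivative)
  qed
  then have "(phi_form l e f i has_derivative (\<lambda>v. \<Sum>k=1..l. (deriv (f k i) w * v) *s e k)) (at w)"
    unfolding phi_form_def[abs_def] by (rule has_derivative_sum)
  note D = frechet_derivative_eqI[OF this]
  show ?thesis unfolding wirt_zbar_def D
    by (simp add: vec_eq_iff sum_component sum_distrib_left flip: sum.distrib)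
       (simp add: algebra_simps flip: power2_eq_square)
qed

lemma wirt_zbar_cong:
  assumes "f differentiable (at w)" "open U" "w \<in> U" "\<And>x. x \<in> U \<Longrightarrow> f x = g x"
  shows "wirt_zbar f w = wirt_zbar g w"
proof -
  have "frechet_derivative f (at w) = frechet_derivative g (at w)"
    by (rule frechet_derivative_transform_within_open) (use assms in auto)
  then show ?thesis by (simp only: wirt_zbar_def)
qed

lemma time_deriv_eq:
  assumes "smooth_on S f" "(0, w) \<in> S" "((\<lambda>t. f (t, w)) has_vector_derivative d) (at 0)"
  shows "dir_deriv f (1, 0) (0, w) = d"
proof -
  have "((\<lambda>t. f (t, w)) has_vector_derivative dir_deriv f (1, 0) (0, w)) (at 0)"
    using dir_deriv_line[of S f "(0, w)" 0 "(1, 0)"] assms(1,2) by (simp add: scaleR_Pair)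
  then show ?thesis using assms(3) by (rule vector_derivative_unique_at)
qed

lemma time_has_vector_derivative:
  assumes "smooth_on S f" "(0, w) \<in> S"
  shows "((\<lambda>t. f (t, w)) has_vector_derivative dir_deriv f (1, 0) (0, w)) (at 0)"
  using dir_deriv_line[of S f "(0, w)" 0 "(1, 0)"] assms by (simp add: scaleR_Pair)

lemma closed_riemann_surface_attains_sup:
  fixes X :: "('i, 'x::t2_space) surface" and u :: "'i \<Rightarrow> complex \<Rightarrow> real"
  assumes X: "closed_riemann_surface X"
    and cont: "\<And>i. continuous_on (chart_img X i) (u i)"
    and compat: "\<And>i j p. p \<in> chart_dom X i \<Longrightarrow> p \<in> chart_dom X j \<Longrightarrow> u i (chart_map X i p) = u j (chart_map X j p)"
  shows "\<exists>i. \<exists>w\<in>chart_img X i. \<forall>j. \<forall>z\<in>chart_img X j. u j z \<le> u i w"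
proof -
  have cover: "(\<Union>i. chart_dom X i) = UNIV" and comp: "compact (UNIV :: 'x set)"
    and dom: "open (chart_dom X i)" and map: "continuous_on (chart_dom X i) (chart_map X i)" for i
    using X by (auto simp: closed_riemann_surface_def homeomorphism_def)
  \<comment> \<open>By \<open>compat\<close> the arbitrary choice of a chart does not affect the
    value, so the local functions glue on the compact surface.\<close>
  define U where "U p = u (SOME i. p \<in> chart_dom X i) (chart_map X (SOME i. p \<in> chart_dom X i) p)" for p
  have U: "U p = u i (chart_map X i p)" if "p \<in> chart_dom X i" for p i
    unfolding U_def by (rule compat[OF someI[of "\<lambda>i. p \<in> chart_dom X i", OF that] that])
  have "continuous_on (chart_dom X i) U" for i
  proof -
    have "continuous_on (chart_dom X i) (\<lambda>p. u i (chart_map X i p))"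
      by (rule continuous_on_compose2[OF cont map]) (auto simp: chart_img_def)
    then show ?thesis using U by (simp cong: continuous_on_cong)
  qed
  then have "continuous_on (\<Union>i\<in>UNIV. chart_dom X i) U"
    by (intro continuous_on_open_UN dom)
  then have "continuous_on UNIV U" using cover by simp
  then obtain p where p: "\<And>p'. U p' \<le> U p"
    using continuous_attains_sup[OF comp UNIV_not_empty] by blast
  obtain i where i: "p \<in> chart_dom X i" using cover by blast
  show ?thesis
  proof (intro exI[of _ i] bexI[of _ "chart_map X i p"] allI ballI)
    fix j z assume "z \<in> chart_img X j"
    then obtain p' where "p' \<in> chart_dom X j" "z = chart_map X j p'" by (auto simp: chart_img_def)
    then show "u j z \<le> u i (chart_map X i p)" using p[of p'] by (simp add: U U[OF i])
  qed (use i in \<open>auto simp: chart_img_def\<close>)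
qed

section \<open>The Fuchsian point\<close>

lemma harmonic_metric_first_variation_zero:
  fixes br :: "complex^'n \<Rightarrow> complex^'n \<Rightarrow> complex^'n"
    and X :: "('i, 'x::t2_space) surface"
    and A \<Phi> :: "real \<Rightarrow> 'i \<Rightarrow> complex \<Rightarrow> complex^'n"
    and R :: "real \<Rightarrow> 'i \<Rightarrow> complex \<Rightarrow> complex^'n \<Rightarrow> complex^'n"
  assumes pl: "principal_lie_alg br a X0 Y0 V m e"
    and cart0: "cartan_involution br \<rho>0" and Y0: "Y0 = \<rho>0 X0" and l: "l = lie_rank br"
    and X: "closed_riemann_surface X" and T: "fuchsian_bundle br a X T"
    and h: "hyperbolic_metric X h" and \<rho>: "fuchsian_metric br a \<rho>0 X h \<rho>"
    and b: "b \<in> Q_space_conj X l m" and \<delta>: "\<delta> > 0"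
    and smA: "\<And>i. smooth_on ({-\<delta><..<\<delta>} \<times> chart_img X i) (\<lambda>(\<epsilon>, w). A \<epsilon> i w)"
    and smPhi: "\<And>i. smooth_on ({-\<delta><..<\<delta>} \<times> chart_img X i) (\<lambda>(\<epsilon>, w). \<Phi> \<epsilon> i w)"
    and smR: "\<And>i v. smooth_on ({-\<delta><..<\<delta>} \<times> chart_img X i) (\<lambda>(\<epsilon>, w). R \<epsilon> i w v)"
    and harm: "\<And>\<epsilon>. \<epsilon> \<in> {-\<delta><..<\<delta>} \<Longrightarrow> harmonic_metric br X T (A \<epsilon>) (\<Phi> \<epsilon>) (R \<epsilon>)"
    and A0: "\<And>i w. w \<in> chart_img X i \<Longrightarrow> A 0 i w = 0"
    and Phi0: "\<And>i w. w \<in> chart_img X i \<Longrightarrow> \<Phi> 0 i w = Y0"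
    and R0: "\<And>i w v. w \<in> chart_img X i \<Longrightarrow> R 0 i w v = \<rho> i w v"
    and Ad: "\<And>i w. w \<in> chart_img X i \<Longrightarrow>
           ((\<lambda>\<epsilon>. A \<epsilon> i w) has_vector_derivative beta_form l e \<rho> b i w) (at 0)"
    and Phid: "\<And>i w. w \<in> chart_img X i \<Longrightarrow>
           ((\<lambda>\<epsilon>. \<Phi> \<epsilon> i w) has_vector_derivative phi_form l e q i w) (at 0)"
    and w: "w \<in> chart_img X i"
  shows "((\<lambda>\<epsilon>. R \<epsilon> i w v) has_vector_derivative 0) (at 0)"
proof -
  interpret P: principal_lie_alg br a X0 Y0 V m e by (rule pl)
  have c0: "cartan_lie_alg br \<rho>0"
    by (intro cartan_lie_alg.intro cartan_lie_alg_axioms.intro P.lie_alg_axioms cart0)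
  interpret C0: cartan_lie_alg br \<rho>0 by (rule c0)
  define S where "S i = {-\<delta><..<\<delta>} \<times> chart_img X i" for i
  define As where "As i p = A (fst p) i (snd p)" for i p
  define Ps where "Ps i p = \<Phi> (fst p) i (snd p)" for i p
  define Rs where "Rs i p = R (fst p) i (snd p)" for i p
  have smAs: "smooth_on (S i) (As i)" and smPs: "smooth_on (S i) (Ps i)" for i
    using smA[of i] smPhi[of i] by (simp_all add: S_def As_def[abs_def] Ps_def[abs_def] case_prod_beta')
  have smRs: "smooth_on (S i) (\<lambda>p. Rs i p v)" for i v
    using smR[of i v] by (simp add: S_def Rs_def case_prod_beta')
  have open_U: "open (chart_img X i)" for i using X by (simp add: closed_riemann_surface_def)
  have open_S: "open (S i)" for i unfolding S_def by (intro open_Times open_U open_greaterThanLessThan)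
  have in_S: "(0, w) \<in> S i" if "w \<in> chart_img X i" for w i using that \<delta> by (simp add: S_def)
  have family: "cartan_family br X T (R \<epsilon>)" if "\<epsilon> \<in> {-\<delta><..<\<delta>}" for \<epsilon>
    using harm[OF that] by (simp add: harmonic_metric_def)
  \<comment> \<open>The (1,0) parts are chosen independently at each time; \<open>smooth_A'\<close>
    supplies their smoothness in time.\<close>
  have "\<forall>\<epsilon>\<in>{-\<delta><..<\<delta>}. \<exists>A'. chern_connection br X (R \<epsilon>) (A \<epsilon>) A' \<and>
      (\<forall>i. \<forall>w\<in>chart_img X i. curvature br (A' i) (A \<epsilon> i) w - br (\<Phi> \<epsilon> i w) (R \<epsilon> i w (\<Phi> \<epsilon> i w)) = 0)"
    using harm by (simp add: harmonic_metric_def)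
  then obtain A' where A': "\<forall>\<epsilon>\<in>{-\<delta><..<\<delta>}. chern_connection br X (R \<epsilon>) (A \<epsilon>) (A' \<epsilon>) \<and>
      (\<forall>i. \<forall>w\<in>chart_img X i. curvature br (A' \<epsilon> i) (A \<epsilon> i) w - br (\<Phi> \<epsilon> i w) (R \<epsilon> i w (\<Phi> \<epsilon> i w)) = 0)"
    by (rule bchoice[THEN exE])
  define A's where "A's i p = A' (fst p) i (snd p)" for i p
  have cv: "chern_variation br \<rho>0 (S i) (Rs i) (As i) (A's i)" for i
  proof (intro chern_variation.intro chern_variation_axioms.intro c0 open_S smRs smAs)
    fix p assume p: "p \<in> S i"
    obtain \<epsilon> w where pw: "p = (\<epsilon>, w)" by (cases p)
    have e: "\<epsilon> \<in> {-\<delta><..<\<delta>}" and w: "w \<in> chart_img X i" using p by (auto simp: S_def pw)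
    show "cartan_involution br (Rs i p)"
      using family[OF e] w by (simp add: cartan_family_def Rs_def pw)
    fix v
    have cc: "wirt_z (\<lambda>w'. R \<epsilon> i w' v) w + br (A' \<epsilon> i w) (R \<epsilon> i w v) = R \<epsilon> i w (br (A \<epsilon> i w) v)"
        "wirt_zbar (\<lambda>w'. R \<epsilon> i w' v) w + br (A \<epsilon> i w) (R \<epsilon> i w v) = R \<epsilon> i w (br (A' \<epsilon> i w) v)"
      using A' e w unfolding chern_connection_def by blast+
    have sl: "wirt_z (\<lambda>w'. R \<epsilon> i w' v) w = wirt (- \<i>) (\<lambda>q. Rs i q v) (\<epsilon>, w)"
        "wirt_zbar (\<lambda>w'. R \<epsilon> i w' v) w = wirt \<i> (\<lambda>q. Rs i q v) (\<epsilon>, w)"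
      using wirt_z_slice[OF smRs p[unfolded pw]] wirt_zbar_slice[OF smRs p[unfolded pw]] by (simp_all add: Rs_def)
    show "wirt (- \<i>) (\<lambda>q. Rs i q v) p + br (A's i p) (Rs i p v) = Rs i p (br (As i p) v)"
      using cc(1) unfolding sl by (simp add: pw Rs_def As_def A's_def)
    show "wirt \<i> (\<lambda>q. Rs i q v) p + br (As i p) (Rs i p v) = Rs i p (br (A's i p) v)"
      using cc(2) unfolding sl by (simp add: pw Rs_def As_def A's_def)
  qed
  have Rs0: "Rs i (0, w) = \<rho> i w" if "w \<in> chart_img X i" for i w
    using R0[OF that] by (auto simp: Rs_def)
  \<comment> \<open>\<open>Y0\<close> has weight \<open>-1\<close>, so the factor
    \<open>h powi (- m)\<close> is \<open>h\<close> itself, and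
    \<open>\<rho>0 Y0 = X0\<close>.\<close>
  have rho_Y0: "\<rho> i w Y0 = of_real (h i w) *s X0" if w: "w \<in> chart_img X i" for i w
  proof -
    have "graded_map br a (\<lambda>m v. (of_real (h i w) powi (- m)) *s \<rho>0 v) (\<rho> i w)"
      using \<rho> w by (simp add: fuchsian_metric_def)
    moreover have "Y0 \<in> grading br a (- 1)" using P.aY by (simp add: grading_def vector_smult_lneg)
    ultimately have "\<rho> i w (\<Sum>m\<in>{-1}. Y0) = (\<Sum>m\<in>{-1}. (of_real (h i w) powi (- m)) *s \<rho>0 Y0)"
      unfolding graded_map_def by (elim allE[of _ "{-1}"] allE[of _ "\<lambda>_. Y0"]) simp
    then show ?thesis using Y0 by simp
  qed
  have hv: "higgs_variation br \<rho>0 (S i) (Rs i) (As i) (A's i) (Ps i) (0, w)" if w: "w \<in> chart_img X i" for i w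
  proof (intro higgs_variation.intro higgs_variation_axioms.intro cv smPs in_S w)
    interpret cv: chern_variation br \<rho>0 "S i" "Rs i" "As i" "A's i" by (rule cv)
    fix p assume p: "p \<in> S i"
    obtain \<epsilon> w where pw: "p = (\<epsilon>, w)" by (cases p)
    have e: "\<epsilon> \<in> {-\<delta><..<\<delta>}" and w: "w \<in> chart_img X i" using p by (auto simp: S_def pw)
    have cu: "wirt_z (A \<epsilon> i) w - wirt_zbar (A' \<epsilon> i) w + br (A' \<epsilon> i w) (A \<epsilon> i w) =
        br (\<Phi> \<epsilon> i w) (R \<epsilon> i w (\<Phi> \<epsilon> i w))"
      using A' e w unfolding curvature_def by (metis eq_iff_diff_eq_0)
    have sl: "wirt_z (A \<epsilon> i) w = wirt (- \<i>) (As i) (\<epsilon>, w)"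
        "wirt_zbar (A' \<epsilon> i) w = wirt \<i> (A's i) (\<epsilon>, w)"
      using wirt_z_slice[OF smAs p[unfolded pw]] wirt_zbar_slice[OF cv.smooth_A' p[unfolded pw]]
      by (simp_all add: As_def[of i "(\<epsilon>, _)"] A's_def[of i "(\<epsilon>, _)"])
    show "wirt (- \<i>) (As i) p - wirt \<i> (A's i) p + br (A's i p) (As i p) = br (Ps i p) (Rs i p (Ps i p))"
      using cu unfolding sl by (simp add: pw Rs_def As_def A's_def Ps_def)
  next
    interpret cv: chern_variation br \<rho>0 "S i" "Rs i" "As i" "A's i" by (rule cv)
    show "As i (0, w) = 0" using A0[OF w] by (simp add: As_def)
    let ?f = "\<lambda>q. Rs i q (dir_deriv (As i) (1, 0) q)"
    have smf: "smooth_on (S i) ?f" by (rule cv.smooth_R_comp[OF smooth_on_dir_deriv[OF smAs]])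
    \<comment> \<open>At time \<open>0\<close> the involution undoes the one in
      \<open>beta_form\<close>, leaving a form with holomorphic coefficients.\<close>
    have slice: "?f (0, z) = phi_form l e (\<lambda>k i w. cnj (b k i w)) i z" if z: "z \<in> chart_img X i" for z
    proof -
      have "dir_deriv (As i) (1, 0) (0, z) = beta_form l e \<rho> b i z"
        by (rule time_deriv_eq[OF smAs in_S[OF z]]) (use Ad[OF z] in \<open>simp add: As_def\<close>)
      then show ?thesis
        using cv.R_R[OF in_S[OF z]] by (simp add: beta_form_def Rs0[OF z])
    qed
    have "wirt \<i> ?f (0, w) = wirt_zbar (\<lambda>z. ?f (0, z)) w"
      by (rule wirt_zbar_slice[OF smf in_S[OF w], symmetric])
    also have "\<dots> = wirt_zbar (phi_form l e (\<lambda>k i w. cnj (b k i w)) i) w"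
      by (rule wirt_zbar_cong[OF differentiableI[OF slice_has_derivative[OF smf in_S[OF w]]] open_U w slice])
    also have "\<dots> = 0"
      by (rule wirt_zbar_phi_form[OF open_U w])
         (use b in \<open>auto simp: Q_space_conj_def Q_space_def holomorphic_differential_def\<close>)
    finally show "wirt \<i> ?f (0, w) = 0" .
    have "dir_deriv (Ps i) (1, 0) (0, w) = phi_form l e q i w"
      by (rule time_deriv_eq[OF smPs in_S[OF w]]) (use Phid[OF w] in \<open>simp add: Ps_def\<close>)
    moreover have "br X0 (phi_form l e q i w) = 0"
      using P.Xe by (simp add: phi_form_def P.br_sum_right P.br_scale_right l)
    ultimately show "br (dir_deriv (Ps i) (1, 0) (0, w)) (Rs i (0, w) (Ps i (0, w))) = 0"
      using P.br_commute[of "phi_form l e q i w" X0]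
      by (simp add: Ps_def Phi0[OF w] Rs0[OF w] rho_Y0[OF w] P.br_scale_right)
  qed
  define s where "s i w = chern_variation.sgen br (Rs i) (0, w)" for i w
  define u where "u i w = Re (killing_form br (s i w) (s i w))" for i w
  have u_eq: "u i w = Re (chern_variation.energy br (Rs i) (0, w))" for i w
    unfolding u_def s_def chern_variation.energy_def[OF cv] ..
  have Rdot: "((\<lambda>t. R t i w v) has_vector_derivative br (s i w) (\<rho> i w v)) (at 0)"
    if w: "w \<in> chart_img X i" for i w v
  proof -
    have "((\<lambda>t. Rs i (t, w) v) has_vector_derivative dir_deriv (\<lambda>q. Rs i q v) (1, 0) (0, w)) (at 0)"
      by (rule time_has_vector_derivative[OF smRs in_S[OF w]])
    moreover have "dir_deriv (\<lambda>q. Rs i q v) (1, 0) (0, w) = br (s i w) (\<rho> i w v)"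
      using chern_variation.Rdot_eq[OF cv in_S[OF w], of v]
      by (simp add: chern_variation.Rdot_def[OF cv] s_def Rs0[OF w])
    ultimately show ?thesis by (simp add: Rs_def)
  qed
  have compat: "u i (chart_map X i p) = u j (chart_map X j p)"
    if p: "p \<in> chart_dom X i" "p \<in> chart_dom X j" for i j p
  proof -
    let ?z = "chart_map X i p" and ?z' = "chart_map X j p" and ?T = "T i j p"
    have z: "?z \<in> chart_img X i" and z': "?z' \<in> chart_img X j" using p by (auto simp: chart_img_def)
    have hh: "h i ?z = (cmod (jac X i j p))\<^sup>2 * h j ?z'" "h i ?z > 0"
      using h p z unfolding hyperbolic_metric_def by blast+
    \<comment> \<open>A zero Jacobian would make the metric coefficient \<open>h i\<close> vanish at
      \<open>p\<close>.\<close>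
    have jac: "jac X i j p \<noteq> 0"
    proof
      assume "jac X i j p = 0"
      then show False using hh by simp
    qed
    have gT: "graded_map br a (\<lambda>m v. (jac X i j p powi m) *s v) ?T"
      using T p unfolding fuchsian_bundle_def by blast
    note linT = P.graded_map_linear[OF gT] and surjT = P.graded_map_surj[OF gT jac]
    have "linear ?T"
      using linT by (auto simp: linear_iff Vector_Spaces.linear_iff scaleR_eq_of_real_vec)
    then have blT: "bounded_linear ?T" by (simp add: linear_conv_bounded_linear)
    have RT: "R \<epsilon> i ?z (?T v) = ?T (R \<epsilon> j ?z' v)" if "\<epsilon> \<in> {-\<delta><..<\<delta>}" for \<epsilon> v
      using family[OF that] p unfolding cartan_family_def by blast
    \<comment> \<open>The transition map does not depend on time, so the gluing rule of the metrics
      can be differentiated through it.\<close>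
    have eq: "br (s i ?z) (\<rho> i ?z (?T v)) = ?T (br (s j ?z') (\<rho> j ?z' v))" for v
    proof (rule vector_derivative_unique_at[OF Rdot[OF z]])
      show "((\<lambda>t. R t i ?z (?T v)) has_vector_derivative ?T (br (s j ?z') (\<rho> j ?z' v))) (at 0)"
        by (rule has_vector_derivative_transform_within_open[OF
              bounded_linear.has_vector_derivative[OF blT Rdot[OF z']], of "{-\<delta><..<\<delta>}"])
           (use \<delta> RT in auto)
    qed
    have "br (s i ?z) (?T x) = ?T (br (s j ?z') x)" for x
    proof -
      have "\<rho> j ?z' (\<rho> j ?z' x) = x"
        using chern_variation.R_R[OF cv in_S[OF z']] by (simp add: Rs0[OF z'])
      moreover have "\<rho> i ?z (?T (\<rho> j ?z' x)) = ?T (\<rho> j ?z' (\<rho> j ?z' x))"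
        using RT[of 0 "\<rho> j ?z' x"] \<delta> by (simp add: R0[OF z] R0[OF z'])
      ultimately show ?thesis using eq[of "\<rho> j ?z' x"] by simp
    qed
    then show ?thesis unfolding u_def using P.killing_form_intertwine[OF linT surjT] by simp
  qed
  have cont: "continuous_on (chart_img X i) (u i)" for i
  proof -
    have "continuous_on (chart_img X i) (\<lambda>w. chern_variation.energy br (Rs i) (0, w))"
      by (rule continuous_on_compose2[OF smooth_on_continuous[OF chern_variation.smooth_energy[OF cv]]])
         (use in_S in \<open>auto intro!: continuous_intros\<close>)
    then show ?thesis unfolding u_eq[abs_def] by (intro continuous_intros)
  qed
  \<comment> \<open>The maximum is taken over all charts at once, so that the bound at
    \<open>w0\<close> later applies in every chart.\<close>
  obtain i0 w0 where w0: "w0 \<in> chart_img X i0" and max: "\<And>j z. z \<in> chart_img X j \<Longrightarrow> u j z \<le> u i0 w0"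
    using closed_riemann_surface_attains_sup[OF X cont compat] by blast
  have rs: "\<rho> i w (s i w) = - s i w" if "w \<in> chart_img X i" for i w
    using chern_variation.R_sgen[OF cv in_S[OF that]] by (simp add: s_def Rs0[OF that])
  have cl: "cartan_lie_alg br (\<rho> i w)" if "w \<in> chart_img X i" for i w
    using chern_variation.cartan_lie_alg_R[OF cv in_S[OF that]] by (simp add: Rs0[OF that])
  have "br (chern_variation.sgen br (Rs i0) (0, w0)) (Ps i0 (0, w0)) = 0"
    by (rule higgs_variation.commute_at_energy_max[OF hv[OF w0]])
       (use max in \<open>auto simp: u_eq S_def\<close>)
  then have "br (s i0 w0) Y0 = 0" by (simp add: s_def Ps_def Phi0[OF w0])
  moreover have "cartan_principal_lie_alg br a X0 Y0 V m e (\<rho> i0 w0) (h i0 w0)"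
  proof (intro cartan_principal_lie_alg.intro cartan_principal_lie_alg_axioms.intro pl cl w0 rho_Y0)
    show "h i0 w0 > 0" using h w0 unfolding hyperbolic_metric_def by blast
  qed
  ultimately have "s i0 w0 = 0"
    using cartan_principal_lie_alg.centralizer_principal_trivial rs[OF w0] by blast
  then have "u i0 w0 = 0" by (simp add: u_def)
  then have "u i w \<le> 0" using max[OF w] by simp
  \<comment> \<open>Since \<open>\<rho> s = - s\<close>, this is the bound
    \<open>|s|^2 \<le> 0\<close>.\<close>
  then have "Re (killing_form br (s i w) (\<rho> i w (s i w))) \<ge> 0"
    by (simp add: rs[OF w] u_def P.killing_form_minus_right)
  then have "s i w = 0" by (rule cartan_lie_alg.eq_zero_if_killing_form_rho[OF cl[OF w]])
  then show ?thesis using Rdot[OF w, of v] by simp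
qed

text \<open>The normalization of the \<open>e k\<close> enters through
  \<open>e k \<noteq> 0\<close>: the Dynkin index is nonzero because \<open>\<rho>0 a = - a\<close>
  and \<open>a \<noteq> 0\<close> make \<open>\<kappa> a a\<close> nonzero.\<close>

lemma principal_lie_algI:
  assumes ss: "semisimple_lie_algebra br" and B: "normalized_killing_form br B"
    and pr: "principal_sl2 br a X0 Y0" and dec: "exponent_decomposition br a X0 Y0 V m"
    and cart: "cartan_involution br \<rho>0" and Y0: "Y0 = \<rho>0 X0"
    and e: "\<And>k. k \<in> {1..lie_rank br} \<Longrightarrow> e k \<in> V k \<and> br a (e k) = of_nat (m k) *s e k \<and> br X0 (e k) = 0 \<and>
           - B (e k) (\<rho>0 (e k)) = dynkin_index B a"
  shows "principal_lie_alg br a X0 Y0 V m e"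
proof -
  have "lie_algebra br" using ss by (simp add: semisimple_lie_algebra_def)
  then interpret cartan_lie_alg br \<rho>0 using cart by unfold_locales
  have rel: "br a X0 = X0" "br a Y0 = - Y0" "br X0 Y0 = - a" and ind: "vec.independent {a, X0, Y0}"
    using pr by (auto simp: principal_sl2_def)
  have a0: "a \<noteq> 0" using ind vec.dependent_zero by blast
  obtain c :: real where c: "c > 0" "\<And>x y. B x y = of_real c * \<kappa> x y"
    using B unfolding normalized_killing_form_def by blast
  \<comment> \<open>The involution exchanges \<open>X0\<close> and \<open>Y0\<close>, hence reverses
    their bracket \<open>- a\<close>.\<close>
  have "\<rho>0 a = - a"
  proof -
    have "- \<rho>0 a = br Y0 X0" using arg_cong[OF rel(3), of \<rho>0] by (simp add: rho_br rho_minus Y0)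
    then show ?thesis using br_commute[of Y0 X0] rel(3) by (metis minus_minus)
  qed
  then have "\<kappa> a a \<noteq> 0" using eq_zero_if_killing_form_rho[of a] a0 by (auto simp: killing_form_minus_right)
  then have "dynkin_index B a \<noteq> 0" using c by (simp add: dynkin_index_def)
  then have "e k \<noteq> 0" if "k \<in> {1..lie_rank br}" for k
    using e[OF that] c by auto
  then show ?thesis
    using rel dec e by unfold_locales auto
qed

theorem theorem3p5p1:
  fixes G :: "'g::t2_space monoid" and C :: "('g set \<times> ('g \<Rightarrow> complex^'n)) set"
    and W :: "'g set" and \<psi> :: "'g \<Rightarrow> complex^'n"
    and br :: "complex^'n \<Rightarrow> complex^'n \<Rightarrow> complex^'n"
    and B :: "complex^'n \<Rightarrow> complex^'n \<Rightarrow> complex"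
    and a X0 Y0 :: "complex^'n" and \<rho>0 :: "complex^'n \<Rightarrow> complex^'n"
    and l :: nat and V :: "nat \<Rightarrow> (complex^'n) set" and m :: "nat \<Rightarrow> nat" and e :: "nat \<Rightarrow> complex^'n"
    and X :: "('i, 'x::t2_space) surface" and g :: nat
    and \<tau> :: "'i \<Rightarrow> 'i \<Rightarrow> 'x \<Rightarrow> 'g"
    and T :: "'i \<Rightarrow> 'i \<Rightarrow> 'x \<Rightarrow> complex^'n \<Rightarrow> complex^'n"
    and h :: "'i \<Rightarrow> complex \<Rightarrow> real"
    and \<rho> :: "'i \<Rightarrow> complex \<Rightarrow> complex^'n \<Rightarrow> complex^'n"
    and q b :: "nat \<Rightarrow> 'i \<Rightarrow> complex \<Rightarrow> complex"
    and \<delta> :: real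
    and A \<Phi> :: "real \<Rightarrow> 'i \<Rightarrow> complex \<Rightarrow> complex^'n"
    and R :: "real \<Rightarrow> 'i \<Rightarrow> complex \<Rightarrow> complex^'n \<Rightarrow> complex^'n"
  assumes "complex_lie_group G C" and "(W, \<psi>) \<in> C" and "\<one>\<^bsub>G\<^esub> \<in> W" and "\<psi> \<one>\<^bsub>G\<^esub> = 0"
    and "br = lie_bracket G W \<psi>" and "semisimple_lie_algebra br" and "l = lie_rank br"
    and "normalized_killing_form br B"
    and "principal_sl2 br a X0 Y0"
    and "exponent_decomposition br a X0 Y0 V m"
    and "cartan_involution br \<rho>0" and "\<rho>0 ` vec.span {a, X0, Y0} = vec.span {a, X0, Y0}"
    and "Y0 = \<rho>0 X0"
    and "\<And>k. k \<in> {1..l} \<Longrightarrow> e k \<in> V k \<and> br a (e k) = of_nat (m k) *s e k \<and> br X0 (e k) = 0 \<and>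
           - B (e k) (\<rho>0 (e k)) = dynkin_index B a"
    and "closed_riemann_surface X" and "has_genus X g" and "g \<ge> 2"
    and "holomorphic_principal_bundle G C X \<tau>" and "T = ad_bundle G W \<psi> \<tau>"
    and "fuchsian_bundle br a X T"
    and "hyperbolic_metric X h" and "fuchsian_metric br a \<rho>0 X h \<rho>"
    and "q \<in> Q_space X l m" and "b \<in> Q_space_conj X l m"
    and "\<delta> > 0"
    and "\<And>i. smooth_on ({-\<delta><..<\<delta>} \<times> chart_img X i) (\<lambda>(\<epsilon>, w). A \<epsilon> i w)"
    and "\<And>i. smooth_on ({-\<delta><..<\<delta>} \<times> chart_img X i) (\<lambda>(\<epsilon>, w). \<Phi> \<epsilon> i w)"
    and "\<And>i v. smooth_on ({-\<delta><..<\<delta>} \<times> chart_img X i) (\<lambda>(\<epsilon>, w). R \<epsilon> i w v)"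
    and "\<And>\<epsilon>. \<epsilon> \<in> {-\<delta><..<\<delta>} \<Longrightarrow> higgs_structure br X T (A \<epsilon>) (\<Phi> \<epsilon>)"
    and "\<And>\<epsilon>. \<epsilon> \<in> {-\<delta><..<\<delta>} \<Longrightarrow> harmonic_metric br X T (A \<epsilon>) (\<Phi> \<epsilon>) (R \<epsilon>)"
    and "\<And>i w. w \<in> chart_img X i \<Longrightarrow> A 0 i w = 0"
    and "\<And>i w. w \<in> chart_img X i \<Longrightarrow> \<Phi> 0 i w = Y0"
    and "\<And>i w v. w \<in> chart_img X i \<Longrightarrow> R 0 i w v = \<rho> i w v"
    and "\<And>i w. w \<in> chart_img X i \<Longrightarrow>
           ((\<lambda>\<epsilon>. A \<epsilon> i w) has_vector_derivative beta_form l e \<rho> b i w) (at 0)"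
    and "\<And>i w. w \<in> chart_img X i \<Longrightarrow>
           ((\<lambda>\<epsilon>. \<Phi> \<epsilon> i w) has_vector_derivative phi_form l e q i w) (at 0)"
  shows "\<forall>i. \<forall>w\<in>chart_img X i. \<forall>v. ((\<lambda>\<epsilon>. R \<epsilon> i w v) has_vector_derivative 0) (at 0)"
proof (intro allI ballI)
  fix i w v
  assume "w \<in> chart_img X i"
  have "principal_lie_alg br a X0 Y0 V m e"
    by (rule principal_lie_algI[OF assms(6,8-11,13)]) (use assms(7,14) in blast)
  then show "((\<lambda>\<epsilon>. R \<epsilon> i w v) has_vector_derivative 0) (at 0)"
    by (rule harmonic_metric_first_variation_zero[OF _ assms(11,13,7,15,20-22,24-28,30-35)]) (assumption | fact)+
qed

end
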